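(* Let $(X_j)_{j\in\mathbb Z}$ be a real Gaussian process with $EX_j=0$ for all $j$, whose covariance matrix $\Sigma=[EX_iX_j]_{i,j\in\mathbb Z}$ acts as a bounded operator on $\ell^2(\mathbb Z)$. If $\Sigma$ has a bounded inverse and belongs to $\mathrm{BDO}$, then the process $(X_j)_{j\in\mathbb Z}$ is regular, and so is the process corresponding to $\Sigma^{-1}$, i.e. the mean-zero Gaussian process indexed by $\mathbb Z$ with covariance matrix $\Sigma^{-1}$.
   Context: A Gaussian process is a sequence of random variables $(X_j)_{j\in\mathbb Z}$ on a probability space whose finite-dimensional joint distributions are Gaussian. For $-\infty\le m\le n\le\infty$, $\mathcal B_m^n$ denotes the $\sigma$-field generated by the $X_j$ with $m\le j\le n$ ($j\in\mathbb Z$). The process is called regular if every event $E\in\mathcal B_{-\infty}:=\bigcap_{t=-\infty}^{\infty}\mathcal B_{-\infty}^t$ satisfies $P(E)\in\{0,1\}$. Bounded operators on $\ell^2=\ell^2(\mathbb Z)$ are identified with their two-sided infinite matrices with respect to the standard basis. $\mathrm{BO}$ is the set of bounded operators on $\ell^2$ whose matrix $(a_{ij})$ is banded, i.e. for some $k$, $a_{ij}=0$ whenever $|i-j|>k$; $\mathrm{BDO}$ is the closure of $\mathrm{BO}$ in the operator norm on $\ell^2$. *)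

theory Defs
  imports "HOL-Probability.Probability"
begin

section \<open>The complex Hilbert space of square-summable two-sided sequences\<close>

typedef ell2 = "{x :: int \<Rightarrow> complex. (\<lambda>i. (cmod (x i))\<^sup>2) summable_on UNIV}"
  morphisms coord Abs_ell2
  by (rule exI[of _ "\<lambda>_. 0"]) simp

setup_lifting type_definition_ell2

lemma ell2_add_summable:
  fixes x y :: "int \<Rightarrow> complex"
  assumes "(\<lambda>i. (cmod (x i))\<^sup>2) summable_on UNIV" "(\<lambda>i. (cmod (y i))\<^sup>2) summable_on UNIV"
  shows "(\<lambda>i. (cmod (x i + y i))\<^sup>2) summable_on UNIV"
proof (rule summable_on_comparison_test)
  show "(\<lambda>i. 2 * (cmod (x i))\<^sup>2 + 2 * (cmod (y i))\<^sup>2) summable_on UNIV"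
    by (intro summable_on_add summable_on_cmult_right assms)
  show "(cmod (x i + y i))\<^sup>2 \<le> 2 * (cmod (x i))\<^sup>2 + 2 * (cmod (y i))\<^sup>2" for i
  proof -
    have "(cmod (x i + y i))\<^sup>2 \<le> (cmod (x i) + cmod (y i))\<^sup>2"
      by (intro power_mono norm_triangle_ineq) auto
    also have "\<dots> \<le> 2 * (cmod (x i))\<^sup>2 + 2 * (cmod (y i))\<^sup>2"
      using sum_squares_bound[of "cmod (x i)" "cmod (y i)"] by (simp add: power2_sum)
    finally show ?thesis .
  qed
qed auto

lemma ell2_scale_summable:
  fixes x :: "int \<Rightarrow> complex"
  assumes "(\<lambda>i. (cmod (x i))\<^sup>2) summable_on UNIV"
  shows "(\<lambda>i. (cmod (c * x i))\<^sup>2) summable_on UNIV"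
  using summable_on_cmult_right[OF assms, of "(cmod c)\<^sup>2"]
  by (simp add: norm_mult power_mult_distrib)

instantiation ell2 :: real_vector
begin

lift_definition zero_ell2 :: ell2 is "\<lambda>_. 0" by simp

lift_definition plus_ell2 :: "ell2 \<Rightarrow> ell2 \<Rightarrow> ell2" is "\<lambda>x y i. x i + y i"
  by (rule ell2_add_summable)

lift_definition uminus_ell2 :: "ell2 \<Rightarrow> ell2" is "\<lambda>x i. - x i" by simp

lift_definition minus_ell2 :: "ell2 \<Rightarrow> ell2 \<Rightarrow> ell2" is "\<lambda>x y i. x i - y i"
  subgoal for x y using ell2_add_summable[of x "\<lambda>i. - y i"] by simp
  done

lift_definition scaleR_ell2 :: "real \<Rightarrow> ell2 \<Rightarrow> ell2" is "\<lambda>r x i. of_real r * x i"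
  by (rule ell2_scale_summable)

instance
  by standard (transfer; simp add: fun_eq_iff algebra_simps)+

end

lift_definition scaleC :: "complex \<Rightarrow> ell2 \<Rightarrow> ell2" (infixr "*\<^sub>C" 75) is "\<lambda>c x i. c * x i"
  by (rule ell2_scale_summable)

text \<open>
  The real inner product below is the real part of the usual complex one.  It only serves to make
  the norm available through the library class \<open>real_inner\<close>.
\<close>

instantiation ell2 :: real_inner
begin

definition norm_ell2 :: "ell2 \<Rightarrow> real"
  where "norm_ell2 x = sqrt (\<Sum>\<^sub>\<infinity>i. (cmod (coord x i))\<^sup>2)"

definition inner_ell2 :: "ell2 \<Rightarrow> ell2 \<Rightarrow> real"
  where "inner_ell2 x y = (\<Sum>\<^sub>\<infinity>i. inner (coord x i) (coord y i))"

definition dist_ell2 :: "ell2 \<Rightarrow> ell2 \<Rightarrow> real"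
  where "dist_ell2 x y = norm (x - y)"

definition sgn_ell2 :: "ell2 \<Rightarrow> ell2"
  where "sgn_ell2 x = x /\<^sub>R norm x"

definition uniformity_ell2 :: "(ell2 \<times> ell2) filter"
  where "uniformity_ell2 = (INF e\<in>{0<..}. principal {(x, y). dist x y < e})"

definition open_ell2 :: "ell2 set \<Rightarrow> bool"
  where "open_ell2 U \<longleftrightarrow> (\<forall>x\<in>U. eventually (\<lambda>(x', y). x' = x \<longrightarrow> y \<in> U) uniformity)"

lemma coord_summable: "(\<lambda>i. (cmod (coord x i))\<^sup>2) summable_on UNIV"
  using coord[of x] by simp

lemma inner_coord_summable: "(\<lambda>i. inner (coord x i) (coord y i)) summable_on UNIV"
proof (rule abs_summable_summable, rule summable_on_comparison_test)
  show "(\<lambda>i. (cmod (coord x i))\<^sup>2 + (cmod (coord y i))\<^sup>2) summable_on UNIV"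
    by (intro summable_on_add coord_summable)
  show "norm (inner (coord x i) (coord y i)) \<le> (cmod (coord x i))\<^sup>2 + (cmod (coord y i))\<^sup>2" for i
    using Cauchy_Schwarz_ineq2[of "coord x i" "coord y i"]
      sum_squares_bound[of "cmod (coord x i)" "cmod (coord y i)"]
      mult_nonneg_nonneg[of "cmod (coord x i)" "cmod (coord y i)"]
    by (simp add: norm_ge_zero)
qed auto

instance
proof
  fix x y z :: ell2 and r :: real
  show "dist x y = norm (x - y)" by (rule dist_ell2_def)
  show "sgn x = x /\<^sub>R norm x" by (rule sgn_ell2_def)
  show "uniformity = (INF e\<in>{0<..}. principal {(x, y :: ell2). dist x y < e})"
    by (rule uniformity_ell2_def)
  show "open U \<longleftrightarrow> (\<forall>x\<in>U. eventually (\<lambda>(x', y). x' = x \<longrightarrow> y \<in> U) uniformity)" for U :: "ell2 set"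
    by (rule open_ell2_def)
  show "inner x y = inner y x" by (simp add: inner_ell2_def inner_commute)
  show "inner (x + y) z = inner x z + inner y z"
    by (simp add: inner_ell2_def plus_ell2.rep_eq inner_add_left infsum_add inner_coord_summable)
  show "inner (r *\<^sub>R x) y = r * inner x y"
  proof -
    have "inner (complex_of_real r * coord x i) (coord y i) = r * inner (coord x i) (coord y i)" for i
      by (simp add: inner_complex_def algebra_simps)
    then show ?thesis
      by (simp add: inner_ell2_def scaleR_ell2.rep_eq infsum_cmult_right')
  qed
  show "0 \<le> inner x x" by (simp add: inner_ell2_def infsum_nonneg)
  show "inner x x = 0 \<longleftrightarrow> x = 0"
  proof
    assume "inner x x = 0"
    then have "inner (coord x i) (coord x i) = 0" for i
      unfolding inner_ell2_def
      using nonneg_infsum_le_0D[of "\<lambda>i. inner (coord x i) (coord x i)" UNIV i] inner_coord_summable[of x x]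
      by simp
    then show "x = 0"
      by (simp add: coord_inject[symmetric] zero_ell2.rep_eq fun_eq_iff)
  qed (simp add: inner_ell2_def zero_ell2.rep_eq)
  show "norm x = sqrt (inner x x)"
    by (simp add: norm_ell2_def inner_ell2_def power2_norm_eq_inner)
qed

end

section \<open>Banded and band-dominated operators\<close>

text \<open>
  The type \<open>ell2 \<Rightarrow>\<^sub>L ell2\<close> consists of the bounded real-linear maps, with the operator norm; the
  bounded operators of the complex space are the complex-linear ones among them.
\<close>

definition bounded_ops :: "(ell2 \<Rightarrow>\<^sub>L ell2) set"
  where "bounded_ops = {A. \<forall>c x. blinfun_apply A (c *\<^sub>C x) = c *\<^sub>C blinfun_apply A x}"

lift_definition basis_vec :: "int \<Rightarrow> ell2" is "\<lambda>j i. if i = j then 1 else 0"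
  subgoal for j
    using summable_on_cong_neutral[of "{j}" UNIV "\<lambda>i. (cmod (if i = j then 1 else 0))\<^sup>2"
        "\<lambda>i. (cmod (if i = j then 1 else 0))\<^sup>2"] by auto
  done

definition matrix_entry :: "(ell2 \<Rightarrow>\<^sub>L ell2) \<Rightarrow> int \<Rightarrow> int \<Rightarrow> complex"
  where "matrix_entry A i j = coord (blinfun_apply A (basis_vec j)) i"

definition BO :: "(ell2 \<Rightarrow>\<^sub>L ell2) set"
  where "BO = {A \<in> bounded_ops. \<exists>k::int. \<forall>i j. \<bar>i - j\<bar> > k \<longrightarrow> matrix_entry A i j = 0}"

definition BDO :: "(ell2 \<Rightarrow>\<^sub>L ell2) set"
  where "BDO = closure BO"

definition is_inverse_op :: "(ell2 \<Rightarrow>\<^sub>L ell2) \<Rightarrow> (ell2 \<Rightarrow>\<^sub>L ell2) \<Rightarrow> bool"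
  where "is_inverse_op A B \<longleftrightarrow> A o\<^sub>L B = id_blinfun \<and> B o\<^sub>L A = id_blinfun"

section \<open>Gaussian processes and regularity\<close>

text \<open>Constants count as (degenerate) Gaussian random variables.\<close>

definition gaussian_rv :: "'a measure \<Rightarrow> ('a \<Rightarrow> real) \<Rightarrow> bool"
  where "gaussian_rv M Z \<longleftrightarrow>
    (\<exists>\<mu> \<sigma>. \<sigma> > 0 \<and> distributed M lborel Z (normal_density \<mu> \<sigma>)) \<or>
    (Z \<in> borel_measurable M \<and> (\<exists>\<mu>. AE \<omega> in M. Z \<omega> = \<mu>))"

text \<open>
  A random vector is Gaussian (possibly with singular covariance) when every linear combination of
  its components is Gaussian.
\<close>

definition gaussian_process :: "'a measure \<Rightarrow> (int \<Rightarrow> 'a \<Rightarrow> real) \<Rightarrow> bool"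
  where "gaussian_process M X \<longleftrightarrow>
    prob_space M \<and> (\<forall>j. X j \<in> borel_measurable M) \<and>
    (\<forall>J u. finite J \<longrightarrow> gaussian_rv M (\<lambda>\<omega>. \<Sum>j\<in>J. u j * X j \<omega>))"

definition centered_gaussian_with_cov ::
    "'a measure \<Rightarrow> (int \<Rightarrow> 'a \<Rightarrow> real) \<Rightarrow> (ell2 \<Rightarrow>\<^sub>L ell2) \<Rightarrow> bool"
  where "centered_gaussian_with_cov M X S \<longleftrightarrow>
    gaussian_process M X \<and>
    (\<forall>j. (\<integral>\<omega>. X j \<omega> \<partial>M) = 0) \<and>
    (\<forall>i j. matrix_entry S i j = complex_of_real (\<integral>\<omega>. X i \<omega> * X j \<omega> \<partial>M))"

definition generated_events :: "'a measure \<Rightarrow> (int \<Rightarrow> 'a \<Rightarrow> real) \<Rightarrow> int set \<Rightarrow> 'a set set"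
  where "generated_events M X J =
    sigma_sets (space M) {X j -` B \<inter> space M |j B. j \<in> J \<and> B \<in> sets borel}"

definition remote_past :: "'a measure \<Rightarrow> (int \<Rightarrow> 'a \<Rightarrow> real) \<Rightarrow> 'a set set"
  where "remote_past M X = (\<Inter>t. generated_events M X {..t})"

definition regular_process :: "'a measure \<Rightarrow> (int \<Rightarrow> 'a \<Rightarrow> real) \<Rightarrow> bool"
  where "regular_process M X \<longleftrightarrow> (\<forall>E\<in>remote_past M X. measure M E = 0 \<or> measure M E = 1)"

end

theory Submission
  imports Defs
begin

text \<open>
  Let \<open>T = \<Sigma>\<^sup>-\<^sup>1\<close>.  The dual variables \<open>Y\<^sub>k = \<Sum>\<^sub>j T\<^sub>k\<^sub>j X\<^sub>j\<close> converge in mean because \<open>\<Sigma>\<close> is bounded, and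
  \<open>E Y\<^sub>k X\<^sub>j = \<delta>\<^sub>k\<^sub>j\<close>, so being jointly Gaussian with the \<open>X\<^sub>j\<close>, every finite family of the \<open>Y\<^sub>k\<close> is
  independent of the \<open>X\<^sub>j\<close> with \<open>j \<le> t\<close> for \<open>t\<close> small.  A remote-past event is therefore independent of
  all the \<open>Y\<^sub>k\<close>; as \<open>X\<^sub>j = \<Sum>\<^sub>k \<Sigma>\<^sub>j\<^sub>k Y\<^sub>k\<close>, it is independent of all the \<open>X\<^sub>j\<close> and hence of itself.
  The covariance matrix of the \<open>Y\<^sub>k\<close> is \<open>T\<close>, which yields the process corresponding to \<open>\<Sigma>\<^sup>-\<^sup>1\<close>.
  Independence is handled through the expectations \<open>E (h cos Z)\<close> and \<open>E (h sin Z)\<close> for finite linear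
  combinations \<open>Z\<close>, so that the uniqueness theorem for characteristic functions on the line suffices.
\<close>

section \<open>Characteristic functions and events\<close>

lemma generated_events_mono: "I \<subseteq> J \<Longrightarrow> generated_events M X I \<subseteq> generated_events M X J"
  unfolding generated_events_def by (intro sigma_sets_mono') blast

context prob_space
begin

section \<open>Centred normal laws and trigonometric expectations\<close>

lemma char_distr_eq:
  assumes [measurable]: "Z \<in> borel_measurable M"
  shows "char (distr M borel Z) s =
    Complex (expectation (\<lambda>\<omega>. cos (s * Z \<omega>))) (expectation (\<lambda>\<omega>. sin (s * Z \<omega>)))"
proof -
  have i: "integrable M (\<lambda>\<omega>. iexp (s * Z \<omega>))"
    by (rule integrable_const_bound[of _ 1]) auto
  have "char (distr M borel Z) s = (CLINT \<omega>|M. iexp (s * Z \<omega>))"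
    by (simp add: char_def integral_distr)
  then show ?thesis
    using integral_Re[OF i] integral_Im[OF i]
    by (simp add: complex_eq_iff Re_exp Im_exp)
qed

text \<open>A centred normal law is encoded as the image of the standard one under multiplication by
  \<open>\<sigma>\<close>. This form includes \<open>\<sigma> = 0\<close>, so the degenerate case of
  \<open>gaussian_rv\<close> merges with the nondegenerate one, and all moments are read off from
  the standard normal distribution.\<close>

lemma scaled_normal_law:
  assumes Z[measurable]: "Z \<in> borel_measurable M"
    and d: "distr M borel Z = distr std_normal_distribution borel (\<lambda>x. \<sigma> * x)"
  shows "integrable M Z" "integrable M (\<lambda>\<omega>. (Z \<omega>)\<^sup>2)" "expectation Z = 0"
    "expectation (\<lambda>\<omega>. (Z \<omega>)\<^sup>2) = \<sigma>\<^sup>2"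
    "expectation (\<lambda>\<omega>. cos (Z \<omega>)) = exp (- \<sigma>\<^sup>2 / 2)" "expectation (\<lambda>\<omega>. sin (Z \<omega>)) = 0"
proof -
  interpret N: real_distribution std_normal_distribution by (rule real_dist_normal_dist)
  have tr: "integrable M (\<lambda>\<omega>. f (Z \<omega>)) \<longleftrightarrow> integrable std_normal_distribution (\<lambda>x. f (\<sigma> * x))"
      "expectation (\<lambda>\<omega>. f (Z \<omega>)) = N.expectation (\<lambda>x. f (\<sigma> * x))"
    if [measurable]: "f \<in> borel_measurable borel" for f :: "real \<Rightarrow> real"
    using integrable_distr_eq[of Z M borel f] integrable_distr_eq[of "\<lambda>x. \<sigma> * x" std_normal_distribution borel f]
      integral_distr[of Z M borel f] integral_distr[of "\<lambda>x. \<sigma> * x" std_normal_distribution borel f] d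
    by auto
  have 1: "integrable std_normal_distribution (\<lambda>x. x)" "integrable std_normal_distribution (\<lambda>x. x\<^sup>2)"
    using integrable_std_normal_distribution_moment[of 1] integrable_std_normal_distribution_moment[of 2] by auto
  have 2: "N.expectation (\<lambda>x. x) = 0" "N.expectation (\<lambda>x. x\<^sup>2) = 1"
    using integral_std_normal_distribution_moment_odd[of 1] std_normal_distribution_even_moments(1)[of 1]
    by (auto simp: fact_numeral)
  have [measurable]: "(\<lambda>x::real. x) \<in> borel_measurable borel" "(\<lambda>x::real. x\<^sup>2) \<in> borel_measurable borel"
    by measurable
  note tr1 = tr[of "\<lambda>x. x"] and tr2 = tr[of "\<lambda>x. x\<^sup>2"]
  have "integrable std_normal_distribution (\<lambda>x. \<sigma> * x)"
    by (intro integrable_mult_right 1)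
  then show "integrable M Z"
    by (intro tr1(1)[THEN iffD2]) measurable
  have "integrable std_normal_distribution (\<lambda>x. \<sigma>\<^sup>2 * x\<^sup>2)"
    by (intro integrable_mult_right 1)
  then show "integrable M (\<lambda>\<omega>. (Z \<omega>)\<^sup>2)"
    by (intro tr2(1)[THEN iffD2]) (simp_all add: power_mult_distrib)
  have "N.expectation (\<lambda>x. \<sigma> * x) = 0"
    by (simp add: 2(1))
  then show "expectation Z = 0"
    by (intro tr1(2)[THEN trans]) measurable
  have "N.expectation (\<lambda>x. (\<sigma> * x)\<^sup>2) = \<sigma>\<^sup>2"
    unfolding power_mult_distrib by (simp add: 2(2))
  then show "expectation (\<lambda>\<omega>. (Z \<omega>)\<^sup>2) = \<sigma>\<^sup>2"
    by (intro tr2(2)[THEN trans]) measurable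
  have "char (distr M borel Z) 1 = char std_normal_distribution \<sigma>"
    unfolding d by (simp add: char_def integral_distr)
  then show "expectation (\<lambda>\<omega>. cos (Z \<omega>)) = exp (- \<sigma>\<^sup>2 / 2)" "expectation (\<lambda>\<omega>. sin (Z \<omega>)) = 0"
    unfolding char_std_normal_distribution char_distr_eq[OF Z] by (auto simp: complex_eq_iff)
qed

lemma gaussian_rv_scaled_normal:
  assumes "gaussian_rv M Z" "expectation Z = 0"
  obtains \<sigma> where "Z \<in> borel_measurable M" "distr M borel Z = distr std_normal_distribution borel (\<lambda>x. \<sigma> * x)"
proof -
  interpret N: real_distribution std_normal_distribution by (rule real_dist_normal_dist)
  consider (normal) \<mu> \<sigma> where "\<sigma> > 0" "distributed M lborel Z (normal_density \<mu> \<sigma>)"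
    | (const) \<mu> where "Z \<in> borel_measurable M" "AE \<omega> in M. Z \<omega> = \<mu>"
    using assms(1) unfolding gaussian_rv_def by blast
  then show ?thesis
  proof cases
    case normal
    have [measurable]: "Z \<in> borel_measurable M"
      using distributed_measurable[OF normal(2)] by simp
    have "\<mu> = 0" using normal_distributed_expectation[OF normal] assms(2) by simp
    then have "distributed M lborel (\<lambda>x. Z x / \<sigma>) std_normal_density"
      using normal normal_standard_normal_convert[of \<sigma> Z 0] by simp
    then have "distr M lborel (\<lambda>x. Z x / \<sigma>) = std_normal_distribution"
      by (rule distributed_distr_eq_density)
    then have "distr (distr M borel (\<lambda>x. Z x / \<sigma>)) borel (\<lambda>x. \<sigma> * x)
        = distr std_normal_distribution borel (\<lambda>x. \<sigma> * x)"
      by (simp cong: distr_cong)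
    moreover have "distr (distr M borel (\<lambda>x. Z x / \<sigma>)) borel (\<lambda>x. \<sigma> * x) = distr M borel Z"
      using normal(1) by (subst distr_distr) (auto simp: comp_def)
    ultimately show ?thesis using that[of \<sigma>] by simp
  next
    case const
    note [measurable] = const(1)
    have "expectation Z = expectation (\<lambda>_. \<mu>)"
      using const by (intro integral_cong_AE) auto
    \<comment> \<open>A centred almost sure constant is zero almost surely, i.e. it has the law of a
      standard normal variable scaled by 0.\<close>
    then have "\<mu> = 0" using assms(2) prob_space by simp
    have "distr M borel Z = distr M borel (\<lambda>_. 0)"
      using const \<open>\<mu> = 0\<close> by (intro distr_cong_AE) auto
    also have "\<dots> = distr std_normal_distribution borel (\<lambda>x. 0 * x)"
      using N.distr_const[of 0 borel] distr_const[of 0 borel] by simp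
    finally show ?thesis using that[of 0] const by simp
  qed
qed

lemma scaled_normal_gaussian_rv:
  assumes [measurable]: "Z \<in> borel_measurable M"
    and d: "distr M borel Z = distr std_normal_distribution borel (\<lambda>x. \<sigma> * x)" and "\<sigma> \<ge> 0"
  shows "gaussian_rv M Z"
proof (cases "\<sigma> = 0")
  case True
  interpret N: real_distribution std_normal_distribution by (rule real_dist_normal_dist)
  have "AE x in distr M borel Z. x = 0"
    unfolding d using True by (simp add: AE_distr_iff)
  then have "AE \<omega> in M. Z \<omega> = 0" by (simp add: AE_distr_iff)
  then show ?thesis unfolding gaussian_rv_def by auto
next
  case False
  then have \<sigma>: "\<sigma> > 0" using assms(3) by simp
  have "distr (distr M borel Z) borel (\<lambda>x. x / \<sigma>) = distr (distr std_normal_distribution borel (\<lambda>x. \<sigma> * x)) borel (\<lambda>x. x / \<sigma>)"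
    by (simp add: d)
  also have "\<dots> = distr std_normal_distribution borel (\<lambda>x. x)"
    using \<sigma> by (subst distr_distr) (auto simp: comp_def)
  also have "\<dots> = std_normal_distribution"
    by (rule distr_id2) simp
  finally have "distr M lborel (\<lambda>x. Z x / \<sigma>) = std_normal_distribution"
    by (subst (asm) distr_distr) (auto simp: comp_def cong: distr_cong)
  then have "distributed M lborel (\<lambda>x. Z x / \<sigma>) std_normal_density"
    unfolding distributed_def by simp
  then have "distributed M lborel Z (normal_density 0 \<sigma>)"
    using \<sigma> normal_standard_normal_convert[of \<sigma> Z 0] by simp
  then show ?thesis unfolding gaussian_rv_def using \<sigma> by blast
qed

text \<open>The sign of \<open>q\<close> is a conclusion: at \<open>s = 1\<close> the cosine
  expectation is at most 1, which forces \<open>q \<ge> 0\<close>. The law then follows by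
  uniqueness of characteristic functions. For represented variables this yields positivity of the
  quadratic form \<open>Q\<close>.\<close>

lemma scaled_normal_if_trig:
  assumes Z[measurable]: "Z \<in> borel_measurable M"
    and c: "\<And>s. expectation (\<lambda>\<omega>. cos (s * Z \<omega>)) = exp (- (s\<^sup>2 * q) / 2)"
    and s: "\<And>s. expectation (\<lambda>\<omega>. sin (s * Z \<omega>)) = 0"
  shows "q \<ge> 0" "distr M borel Z = distr std_normal_distribution borel (\<lambda>x. sqrt q * x)"
proof -
  interpret N: real_distribution std_normal_distribution by (rule real_dist_normal_dist)
  have "expectation (\<lambda>\<omega>. cos (1 * Z \<omega>)) \<le> expectation (\<lambda>_. 1)"
    by (intro integral_mono integrable_const_bound[of _ 1]) auto
  then show q: "q \<ge> 0" unfolding c by (simp add: prob_space)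
  show "distr M borel Z = distr std_normal_distribution borel (\<lambda>x. sqrt q * x)"
  proof (rule Levy_uniqueness)
    show "real_distribution (distr M borel Z)" by simp
    show "real_distribution (distr std_normal_distribution borel (\<lambda>x. sqrt q * x))"
      by (rule N.real_distribution_distr) simp
    have "char (distr std_normal_distribution borel (\<lambda>x. sqrt q * x)) t = char std_normal_distribution (sqrt q * t)" for t
      by (simp add: char_def integral_distr mult_ac)
    then show "char (distr M borel Z) = char (distr std_normal_distribution borel (\<lambda>x. sqrt q * x))"
      using q by (simp add: fun_eq_iff char_distr_eq[OF Z] c s char_std_normal_distribution complex_eq_iff
          power_mult_distrib mult_ac)
  qed
qed

text \<open>This is nonnegativity of the variance of the absolute value. It turns bounds on second
  moments into bounds in mean.\<close>

lemma abs_expectation_le_sqrt: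
  assumes [measurable]: "Z \<in> borel_measurable M" and "integrable M (\<lambda>\<omega>. (Z \<omega>)\<^sup>2)"
  shows "expectation (\<lambda>\<omega>. \<bar>Z \<omega>\<bar>) \<le> sqrt (expectation (\<lambda>\<omega>. (Z \<omega>)\<^sup>2))"
proof (rule real_le_rsqrt)
  have i: "integrable M Z"
    using square_integrable_imp_integrable[OF assms(1)] assms(2) by simp
  have "0 \<le> variance (\<lambda>\<omega>. \<bar>Z \<omega>\<bar>)" by simp
  then show "(expectation (\<lambda>\<omega>. \<bar>Z \<omega>\<bar>))\<^sup>2 \<le> expectation (\<lambda>\<omega>. (Z \<omega>)\<^sup>2)"
    using i assms(2) by (subst (asm) variance_eq) auto
qed

text \<open>The weight \<open>1 + A\<close> is the density of a probability measure, which turns the hypothesis into an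
  equality of characteristic functions.\<close>

lemma trig_orthogonal_imp_indicator_orthogonal:
  fixes Z A :: "'a \<Rightarrow> real"
  assumes [measurable]: "Z \<in> borel_measurable M" "A \<in> borel_measurable M"
    and bd: "\<And>\<omega>. \<bar>A \<omega>\<bar> \<le> 1"
    and c: "\<And>s. expectation (\<lambda>\<omega>. A \<omega> * cos (s * Z \<omega>)) = 0"
    and s: "\<And>s. expectation (\<lambda>\<omega>. A \<omega> * sin (s * Z \<omega>)) = 0"
    and B[measurable]: "B \<in> sets borel"
  shows "expectation (\<lambda>\<omega>. A \<omega> * indicator B (Z \<omega>)) = 0"
proof -
  have nn: "1 + A \<omega> \<ge> 0" for \<omega> using bd[of \<omega>] by (simp add: abs_le_iff)
  have bi: "integrable M (\<lambda>\<omega>. A \<omega> * f \<omega>)"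
    if [measurable]: "f \<in> borel_measurable M" and "\<And>\<omega>. \<bar>f \<omega>\<bar> \<le> 1" for f
  proof (rule integrable_const_bound[of _ 1])
    have "norm (A \<omega> * f \<omega>) \<le> 1 * 1" for \<omega>
      unfolding norm_mult using bd that(2) by (intro mult_mono) auto
    then show "AE \<omega> in M. norm (A \<omega> * f \<omega>) \<le> 1" by simp
  qed simp
  have Ai: "integrable M A" using bi[of "\<lambda>_. 1"] by simp
  \<comment> \<open>At \<open>s = 0\<close> the cosine is 1, so the hypothesis contains that
    \<open>A\<close> has mean zero; this gives \<open>D\<close> total mass one.\<close>
  have A0: "expectation A = 0" using c[of 0] by simp
  define D where "D = density M (\<lambda>\<omega>. ennreal (1 + A \<omega>))"
  have sD[simp, measurable_cong]: "sets D = sets M" "space D = space M" by (auto simp: D_def)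
  have "emeasure D (space D) = ennreal (expectation (\<lambda>\<omega>. 1 + A \<omega>))"
    unfolding D_def using nn Ai
    by (subst emeasure_density) (auto simp: nn_integral_eq_integral cong: nn_integral_cong)
  also have "\<dots> = 1" using Ai A0 by (simp add: prob_space)
  finally interpret D: prob_space D by (rule prob_spaceI)
  have ZD[measurable]: "Z \<in> borel_measurable D" by simp
  \<comment> \<open>The change of measure adds exactly the expectation of
    \<open>A \<omega> * f \<omega>\<close>, so orthogonality of \<open>A\<close> to \<open>f\<close>
    is the same as equality of the expectations of \<open>f\<close> under \<open>D\<close> and
    \<open>M\<close>. This is used forwards for cosine and sine, and backwards for the indicator of
    \<open>B\<close>.\<close>
  have eq: "D.expectation f = expectation f + expectation (\<lambda>\<omega>. A \<omega> * f \<omega>)"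
    if [measurable]: "f \<in> borel_measurable M" and b: "\<And>\<omega>. \<bar>f \<omega>\<bar> \<le> 1" for f
  proof -
    have fi: "integrable M f"
      by (rule integrable_const_bound[of _ 1]) (use b in auto)
    have "D.expectation f = expectation (\<lambda>\<omega>. (1 + A \<omega>) * f \<omega>)"
      unfolding D_def using nn by (subst integral_density) auto
    also have "\<dots> = expectation (\<lambda>\<omega>. f \<omega> + A \<omega> * f \<omega>)"
      by (simp add: algebra_simps)
    finally show ?thesis using fi bi[OF that] by simp
  qed
  have "char (distr D borel Z) t = char (distr M borel Z) t" for t
    unfolding char_distr_eq[OF assms(1)] D.char_distr_eq[OF ZD]
    using c[of t] s[of t] by (simp add: eq)
  then have "distr D borel Z = distr M borel Z"
    by (intro Levy_uniqueness D.real_distribution_distr real_distribution_distr) auto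
  moreover have "D.expectation (\<lambda>\<omega>. indicator B (Z \<omega>)) = integral\<^sup>L (distr D borel Z) (indicator B :: real \<Rightarrow> real)"
    by (subst integral_distr) auto
  moreover have "expectation (\<lambda>\<omega>. indicator B (Z \<omega>)) = integral\<^sup>L (distr M borel Z) (indicator B :: real \<Rightarrow> real)"
    by (subst integral_distr) auto
  ultimately show ?thesis
    using eq[of "\<lambda>\<omega>. indicator B (Z \<omega>)"] by (simp split: split_indicator)
qed

section \<open>Orthogonality to the sigma-field generated by a family of variables\<close>

text \<open>Intended meaning: the conditional expectation of \<open>h\<close> given the
  \<open>X j\<close> with \<open>j \<in> I\<close> vanishes. The empty combination contains that
  \<open>h\<close> has mean zero. The bound 1 keeps all products integrable and is preserved under
  multiplication by indicators, cosines and sines.\<close>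

definition trig_orthogonal :: "('i \<Rightarrow> 'a \<Rightarrow> real) \<Rightarrow> 'i set \<Rightarrow> ('a \<Rightarrow> real) \<Rightarrow> bool"
  where "trig_orthogonal X I h \<longleftrightarrow> h \<in> borel_measurable M \<and> (\<forall>\<omega>. \<bar>h \<omega>\<bar> \<le> 1) \<and>
    (\<forall>J u. finite J \<longrightarrow> J \<subseteq> I \<longrightarrow>
      expectation (\<lambda>\<omega>. h \<omega> * cos (\<Sum>j\<in>J. u j * X j \<omega>)) = 0 \<and>
      expectation (\<lambda>\<omega>. h \<omega> * sin (\<Sum>j\<in>J. u j * X j \<omega>)) = 0)"

lemma integrable_bounded_mult:
  fixes h g :: "'a \<Rightarrow> real"
  assumes [measurable]: "h \<in> borel_measurable M" "g \<in> borel_measurable M"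
    and h: "\<And>\<omega>. \<bar>h \<omega>\<bar> \<le> 1" and g: "\<And>\<omega>. \<bar>g \<omega>\<bar> \<le> 1"
  shows "integrable M (\<lambda>\<omega>. h \<omega> * g \<omega>)"
proof (rule integrable_const_bound[of _ 1])
  have "norm (h \<omega> * g \<omega>) \<le> 1 * 1" for \<omega>
    unfolding norm_mult using h g by (intro mult_mono) auto
  then show "AE \<omega> in M. norm (h \<omega> * g \<omega>) \<le> 1" by simp
qed simp

text \<open>The product-to-sum formulas leave trigonometric functions of Z plus or minus
  \<open>s * X i \<omega>\<close>, which are again finite combinations over \<open>I\<close>. Thus h
  cos Z and h sin Z qualify as the weight \<open>A\<close> of the preceding lemma for the single
  variable \<open>X i\<close>.\<close>

lemma trig_orthogonal_shift:
  fixes X :: "'i \<Rightarrow> 'a \<Rightarrow> real" and u :: "'i \<Rightarrow> real"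
  assumes X: "\<And>j. j \<in> I \<Longrightarrow> X j \<in> borel_measurable M"
    and h: "trig_orthogonal X I h" and J: "finite J" "J \<subseteq> I" and i: "i \<in> I"
  defines "Z \<equiv> \<lambda>\<omega>. \<Sum>j\<in>J. u j * X j \<omega>"
  shows "expectation (\<lambda>\<omega>. (h \<omega> * cos (Z \<omega>)) * cos (s * X i \<omega>)) = 0"
    "expectation (\<lambda>\<omega>. (h \<omega> * cos (Z \<omega>)) * sin (s * X i \<omega>)) = 0"
    "expectation (\<lambda>\<omega>. (h \<omega> * sin (Z \<omega>)) * cos (s * X i \<omega>)) = 0"
    "expectation (\<lambda>\<omega>. (h \<omega> * sin (Z \<omega>)) * sin (s * X i \<omega>)) = 0"
proof -
  have hm[measurable]: "h \<in> borel_measurable M" and hb: "\<And>\<omega>. \<bar>h \<omega>\<bar> \<le> 1"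
    using h by (auto simp: trig_orthogonal_def)
  \<comment> \<open>The index \<open>i\<close> may already lie in \<open>J\<close>; its two
    coefficients are then added, so that the combination runs over \<open>insert i J\<close> as a
    set.\<close>
  define v where "v = (\<lambda>t j. (if j \<in> J then u j else 0) + (if j = i then t else 0))"
  define W where "W = (\<lambda>t \<omega>. Z \<omega> + t * X i \<omega>)"
  have W: "W t \<omega> = (\<Sum>j\<in>insert i J. v t j * X j \<omega>)" for t \<omega>
  proof -
    have "(\<Sum>j\<in>insert i J. v t j * X j \<omega>) =
      (\<Sum>j\<in>insert i J. (if j \<in> J then u j * X j \<omega> else 0)) + (\<Sum>j\<in>insert i J. if j = i then t * X i \<omega> else 0)"
      unfolding sum.distrib[symmetric] by (intro sum.cong) (auto simp: v_def algebra_simps)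
    also have "(\<Sum>j\<in>insert i J. (if j \<in> J then u j * X j \<omega> else 0)) = Z \<omega>"
      unfolding Z_def using J by (subst sum.inter_restrict[symmetric]) (auto intro!: sum.cong)
    also have "(\<Sum>j\<in>insert i J. if j = i then t * X i \<omega> else 0) = t * X i \<omega>"
      using J by simp
    finally show ?thesis by (simp add: W_def)
  qed
  have z: "expectation (\<lambda>\<omega>. h \<omega> * cos (W t \<omega>)) = 0" "expectation (\<lambda>\<omega>. h \<omega> * sin (W t \<omega>)) = 0" for t
    unfolding W using h J i by (auto simp: trig_orthogonal_def)
  have Zm: "Z \<in> borel_measurable M"
    unfolding Z_def using J X by (intro borel_measurable_sum) auto
  have [measurable]: "W t \<in> borel_measurable M" for t
    unfolding W_def using Zm X i by simp
  have ci: "integrable M (\<lambda>\<omega>. h \<omega> * cos (W t \<omega>))" and si: "integrable M (\<lambda>\<omega>. h \<omega> * sin (W t \<omega>))" for t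
    using hb by (auto intro!: integrable_bounded_mult)
  have a: "cos a * cos b = (cos (a + b) + cos (a + - b)) / 2"
    "cos a * sin b = (sin (a + b) - sin (a + - b)) / 2"
    "sin a * cos b = (sin (a + b) + sin (a + - b)) / 2"
    "sin a * sin b = (cos (a + - b) - cos (a + b)) / 2" for a b :: real
    by (simp_all add: cos_add sin_add cos_diff sin_diff)
  have WW: "Z \<omega> + s * X i \<omega> = W s \<omega>" "Z \<omega> + - (s * X i \<omega>) = W (- s) \<omega>" for \<omega>
    by (auto simp: W_def)
  note ds = ring_distribs diff_divide_distrib add_divide_distrib times_divide_eq_right
  show "expectation (\<lambda>\<omega>. (h \<omega> * cos (Z \<omega>)) * cos (s * X i \<omega>)) = 0"
    "expectation (\<lambda>\<omega>. (h \<omega> * cos (Z \<omega>)) * sin (s * X i \<omega>)) = 0"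
    "expectation (\<lambda>\<omega>. (h \<omega> * sin (Z \<omega>)) * cos (s * X i \<omega>)) = 0"
    "expectation (\<lambda>\<omega>. (h \<omega> * sin (Z \<omega>)) * sin (s * X i \<omega>)) = 0"
    unfolding mult.assoc a WW ds using ci[of s] ci[of "-s"] si[of s] si[of "-s"] z[of s] z[of "-s"]
    by simp_all
qed

text \<open>One-dimensional uniqueness is applied to the variable \<open>X i\<close> alone, while
  all other variables are carried along inside the weight h cos Z or h sin Z. Since the result is
  again of the form \<open>trig_orthogonal\<close>, further indicators can be multiplied in.\<close>

lemma trig_orthogonal_indicator_generator:
  fixes X :: "'i \<Rightarrow> 'a \<Rightarrow> real"
  assumes X: "\<And>j. j \<in> I \<Longrightarrow> X j \<in> borel_measurable M"
    and h: "trig_orthogonal X I h" and i: "i \<in> I" and B: "B \<in> sets borel"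
  shows "trig_orthogonal X I (\<lambda>\<omega>. h \<omega> * indicator (X i -` B \<inter> space M) \<omega>)"
  unfolding trig_orthogonal_def
proof (intro conjI allI impI)
  have hm[measurable]: "h \<in> borel_measurable M" and hb: "\<And>\<omega>. \<bar>h \<omega>\<bar> \<le> 1"
    using h by (auto simp: trig_orthogonal_def)
  have [measurable]: "X i \<in> borel_measurable M" "B \<in> sets borel" using X i B by auto
  show "(\<lambda>\<omega>. h \<omega> * indicator (X i -` B \<inter> space M) \<omega>) \<in> borel_measurable M" by measurable
  show "\<bar>h \<omega> * indicator (X i -` B \<inter> space M) \<omega>\<bar> \<le> 1" for \<omega>
    using hb[of \<omega>] by (auto split: split_indicator)
  fix J :: "'i set" and u :: "'i \<Rightarrow> real" assume J: "finite J" "J \<subseteq> I"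
  define Z where "Z = (\<lambda>\<omega>. \<Sum>j\<in>J. u j * X j \<omega>)"
  have [measurable]: "Z \<in> borel_measurable M"
    unfolding Z_def using J X by (intro borel_measurable_sum) auto
  have sh: "expectation (\<lambda>\<omega>. (h \<omega> * cos (Z \<omega>)) * cos (s * X i \<omega>)) = 0"
    "expectation (\<lambda>\<omega>. (h \<omega> * cos (Z \<omega>)) * sin (s * X i \<omega>)) = 0"
    "expectation (\<lambda>\<omega>. (h \<omega> * sin (Z \<omega>)) * cos (s * X i \<omega>)) = 0"
    "expectation (\<lambda>\<omega>. (h \<omega> * sin (Z \<omega>)) * sin (s * X i \<omega>)) = 0" for s
    unfolding Z_def by (rule trig_orthogonal_shift[of I X, OF X h J i]; assumption)+
  have b: "\<bar>h \<omega> * cos (Z \<omega>)\<bar> \<le> 1" "\<bar>h \<omega> * sin (Z \<omega>)\<bar> \<le> 1" for \<omega>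
    using mult_mono[OF hb[of \<omega>] abs_cos_le_one[of "Z \<omega>"]] mult_mono[OF hb[of \<omega>] abs_sin_le_one[of "Z \<omega>"]]
    by (auto simp: abs_mult)
  have "expectation (\<lambda>\<omega>. h \<omega> * indicator (X i -` B \<inter> space M) \<omega> * cos (Z \<omega>)) =
      expectation (\<lambda>\<omega>. (h \<omega> * cos (Z \<omega>)) * indicator B (X i \<omega>))"
    by (intro Bochner_Integration.integral_cong) (auto split: split_indicator)
  also have "\<dots> = 0"
    by (rule trig_orthogonal_imp_indicator_orthogonal[of "X i"]) (use sh b B in auto)
  finally show "expectation (\<lambda>\<omega>. h \<omega> * indicator (X i -` B \<inter> space M) \<omega> * cos (\<Sum>j\<in>J. u j * X j \<omega>)) = 0"
    by (simp add: Z_def)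
  have "expectation (\<lambda>\<omega>. h \<omega> * indicator (X i -` B \<inter> space M) \<omega> * sin (Z \<omega>)) =
      expectation (\<lambda>\<omega>. (h \<omega> * sin (Z \<omega>)) * indicator B (X i \<omega>))"
    by (intro Bochner_Integration.integral_cong) (auto split: split_indicator)
  also have "\<dots> = 0"
    by (rule trig_orthogonal_imp_indicator_orthogonal[of "X i"]) (use sh b B in auto)
  finally show "expectation (\<lambda>\<omega>. h \<omega> * indicator (X i -` B \<inter> space M) \<omega> * sin (\<Sum>j\<in>J. u j * X j \<omega>)) = 0"
    by (simp add: Z_def)
qed

lemma trig_orthogonal_diff_indicator:
  fixes X :: "'i \<Rightarrow> 'a \<Rightarrow> real"
  assumes X: "\<And>j. j \<in> I \<Longrightarrow> X j \<in> borel_measurable M"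
    and h: "trig_orthogonal X I h" and hA: "trig_orthogonal X I (\<lambda>\<omega>. h \<omega> * indicator A \<omega>)"
    and A: "A \<in> sets M"
  shows "trig_orthogonal X I (\<lambda>\<omega>. h \<omega> * indicator (space M - A) \<omega>)"
  unfolding trig_orthogonal_def
proof (intro conjI allI impI)
  have hm[measurable]: "h \<in> borel_measurable M" and hb: "\<And>\<omega>. \<bar>h \<omega>\<bar> \<le> 1"
    using h by (auto simp: trig_orthogonal_def)
  note [measurable] = A
  show "(\<lambda>\<omega>. h \<omega> * indicator (space M - A) \<omega>) \<in> borel_measurable M" by measurable
  show "\<bar>h \<omega> * indicator (space M - A) \<omega>\<bar> \<le> 1" for \<omega>
    using hb[of \<omega>] by (auto split: split_indicator)
  have hAb: "\<bar>h \<omega> * indicator A \<omega>\<bar> \<le> 1" for \<omega>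
    using hb[of \<omega>] by (auto split: split_indicator)
  have *: "expectation (\<lambda>\<omega>. h \<omega> * indicator (space M - A) \<omega> * g \<omega>) =
      expectation (\<lambda>\<omega>. h \<omega> * g \<omega>) - expectation (\<lambda>\<omega>. h \<omega> * indicator A \<omega> * g \<omega>)"
    if [measurable]: "g \<in> borel_measurable M" and g: "\<And>\<omega>. \<bar>g \<omega>\<bar> \<le> 1" for g :: "'a \<Rightarrow> real"
  proof -
    have "expectation (\<lambda>\<omega>. h \<omega> * indicator (space M - A) \<omega> * g \<omega>) =
      expectation (\<lambda>\<omega>. h \<omega> * g \<omega> - h \<omega> * indicator A \<omega> * g \<omega>)"
      by (intro Bochner_Integration.integral_cong) (auto split: split_indicator)
    then show ?thesis
      using integrable_bounded_mult[OF hm _ hb g] integrable_bounded_mult[OF _ _ hAb g]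
      by simp
  qed
  fix J :: "'i set" and u :: "'i \<Rightarrow> real" assume J: "finite J" "J \<subseteq> I"
  have [measurable]: "(\<lambda>\<omega>. \<Sum>j\<in>J. u j * X j \<omega>) \<in> borel_measurable M"
    using J X by (intro borel_measurable_sum) auto
  show "expectation (\<lambda>\<omega>. h \<omega> * indicator (space M - A) \<omega> * cos (\<Sum>j\<in>J. u j * X j \<omega>)) = 0"
    "expectation (\<lambda>\<omega>. h \<omega> * indicator (space M - A) \<omega> * sin (\<Sum>j\<in>J. u j * X j \<omega>)) = 0"
    using h hA J by (simp_all add: * trig_orthogonal_def)
qed

lemma trig_orthogonal_LIMSEQ:
  fixes X :: "'i \<Rightarrow> 'a \<Rightarrow> real"
  assumes X: "\<And>j. j \<in> I \<Longrightarrow> X j \<in> borel_measurable M"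
    and h: "\<And>n::nat. trig_orthogonal X I (h n)" and lim: "\<And>\<omega>. (\<lambda>n. h n \<omega>) \<longlonglongrightarrow> k \<omega>"
  shows "trig_orthogonal X I k"
  unfolding trig_orthogonal_def
proof (intro conjI allI impI)
  have hm[measurable]: "h n \<in> borel_measurable M" and hb: "\<bar>h n \<omega>\<bar> \<le> 1" for n \<omega>
    using h by (auto simp: trig_orthogonal_def)
  show [measurable]: "k \<in> borel_measurable M"
    by (rule borel_measurable_LIMSEQ_real[OF lim]) simp_all
  show "\<bar>k \<omega>\<bar> \<le> 1" for \<omega>
    by (rule LIMSEQ_le_const2[OF tendsto_rabs[OF lim]]) (use hb in auto)
  have *: "expectation (\<lambda>\<omega>. k \<omega> * g \<omega>) = 0"
    if [measurable]: "g \<in> borel_measurable M" and g: "\<And>\<omega>. \<bar>g \<omega>\<bar> \<le> 1"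
      and z: "\<And>n. expectation (\<lambda>\<omega>. h n \<omega> * g \<omega>) = 0" for g :: "'a \<Rightarrow> real"
  proof -
    have "(\<lambda>n. expectation (\<lambda>\<omega>. h n \<omega> * g \<omega>)) \<longlonglongrightarrow> expectation (\<lambda>\<omega>. k \<omega> * g \<omega>)"
    proof (rule integral_dominated_convergence[where w="\<lambda>_. 1"])
      have "norm (h n \<omega> * g \<omega>) \<le> 1 * 1" for \<omega> n
        unfolding norm_mult using hb g by (intro mult_mono) auto
      then show "AE \<omega> in M. norm (h n \<omega> * g \<omega>) \<le> 1" for n by simp
    qed (auto intro!: tendsto_intros lim)
    then show ?thesis using z by (simp add: LIMSEQ_const_iff)
  qed
  fix J :: "'i set" and u :: "'i \<Rightarrow> real" assume J: "finite J" "J \<subseteq> I"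
  have [measurable]: "(\<lambda>\<omega>. \<Sum>j\<in>J. u j * X j \<omega>) \<in> borel_measurable M"
    using J X by (intro borel_measurable_sum) auto
  show "expectation (\<lambda>\<omega>. k \<omega> * cos (\<Sum>j\<in>J. u j * X j \<omega>)) = 0"
    "expectation (\<lambda>\<omega>. k \<omega> * sin (\<Sum>j\<in>J. u j * X j \<omega>)) = 0"
    using h J by (auto intro!: * simp: trig_orthogonal_def)
qed

lemma generated_events_sets:
  assumes "\<And>j. j \<in> I \<Longrightarrow> X j \<in> borel_measurable M"
  shows "generated_events M X I \<subseteq> sets M"
  unfolding generated_events_def using assms
  by (intro sets.sigma_sets_subset) (auto intro: measurable_sets)

lemma trig_orthogonal_indicator:
  assumes X: "\<And>j. j \<in> I \<Longrightarrow> X j \<in> borel_measurable M"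
    and A: "A \<in> generated_events M X I" and h: "trig_orthogonal X I h"
  shows "trig_orthogonal X I (\<lambda>\<omega>. h \<omega> * indicator A \<omega>)"
proof -
  \<comment> \<open>The property quantifies over all \<open>h\<close>, so it can be applied twice in
    a row. This gives closure under intersections at once, hence under finite unions by complements,
    and the induction over \<open>sigma_sets\<close> can proceed directly.\<close>
  define P where "P = (\<lambda>A. A \<in> sets M \<and> (\<forall>h. trig_orthogonal X I h \<longrightarrow> trig_orthogonal X I (\<lambda>\<omega>. h \<omega> * indicator A \<omega>)))"
  have compl: "P (space M - A)" if "P A" for A
    using that trig_orthogonal_diff_indicator[of I X, OF X] unfolding P_def by auto
  have int: "P (A \<inter> B)" if "P A" "P B" for A B
    unfolding P_def
  proof (intro conjI allI impI)
    show "A \<inter> B \<in> sets M" using that by (auto simp: P_def)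
    fix h assume "trig_orthogonal X I h"
    then have "trig_orthogonal X I (\<lambda>\<omega>. h \<omega> * indicator A \<omega> * indicator B \<omega>)"
      using that by (auto simp: P_def)
    then show "trig_orthogonal X I (\<lambda>\<omega>. h \<omega> * indicator (A \<inter> B) \<omega>)"
      by (simp add: indicator_inter_arith mult.assoc)
  qed
  have un: "P (A \<union> B)" if "P A" "P B" for A B
  proof -
    have "A \<union> B = space M - ((space M - A) \<inter> (space M - B))"
      using that sets.sets_into_space by (auto simp: P_def)
    then show ?thesis using compl int that by metis
  qed
  have empty: "P {}"
    unfolding P_def by (simp add: trig_orthogonal_def)
  have "P A"
    using A unfolding generated_events_def
  proof (induct rule: sigma_sets.induct)
    case (Basic a)
    then show ?case
      using X trig_orthogonal_indicator_generator[of I X, OF X] unfolding P_def by (auto intro: measurable_sets)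
  next
    case (Union a)
    \<comment> \<open>The sets \<open>a i\<close> may overlap; their finite unions increase to the
      whole union, with pointwise convergence of the indicators.\<close>
    have fin: "P (\<Union>i<n. a i)" for n
      by (induct n) (simp_all add: empty lessThan_Suc un Union)
    show ?case
      unfolding P_def
    proof (intro conjI allI impI)
      show "(\<Union>i. a i) \<in> sets M" using Union by (auto simp: P_def)
      fix h assume h: "trig_orthogonal X I h"
      show "trig_orthogonal X I (\<lambda>\<omega>. h \<omega> * indicator (\<Union>i. a i) \<omega>)"
      proof (rule trig_orthogonal_LIMSEQ[of I X, OF X])
        show "trig_orthogonal X I (\<lambda>\<omega>. h \<omega> * indicator (\<Union>i<n. a i) \<omega>)" for n
          using fin h by (auto simp: P_def)
        show "(\<lambda>n. h \<omega> * indicator (\<Union>i<n. a i) \<omega>) \<longlonglongrightarrow> h \<omega> * indicator (\<Union>i. a i) \<omega>" for \<omega>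
          by (intro tendsto_intros LIMSEQ_indicator_UN)
      qed
    qed
  qed (fact empty, rule compl)
  then show ?thesis using h by (simp add: P_def)
qed

lemma trig_orthogonal_expectation_indicator:
  assumes X: "\<And>j. j \<in> I \<Longrightarrow> X j \<in> borel_measurable M"
    and "A \<in> generated_events M X I" "trig_orthogonal X I h"
  shows "expectation (\<lambda>\<omega>. h \<omega> * indicator A \<omega>) = 0"
proof -
  have "trig_orthogonal X I (\<lambda>\<omega>. h \<omega> * indicator A \<omega>)"
    by (rule trig_orthogonal_indicator[of I X]) (use assms in auto)
  then have "expectation (\<lambda>\<omega>. h \<omega> * indicator A \<omega> * cos (\<Sum>j\<in>J. u j * X j \<omega>)) = 0"
    if "finite J" "J \<subseteq> I" for J u
    using that by (simp add: trig_orthogonal_def)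
  \<comment> \<open>The empty combination has cosine 1.\<close>
  from this[of "{}" "\<lambda>_. 0"] show ?thesis by simp
qed

end

section \<open>Convergence in mean\<close>

text \<open>The increments have summable means, so their series converges absolutely almost
  everywhere and telescopes to a limit. The distance in mean from the limit to \<open>f n\<close> is
  bounded by the tail of that summable series.\<close>

lemma L1_complete_geometric:
  fixes f :: "nat \<Rightarrow> 'a \<Rightarrow> real"
  assumes f: "\<And>n. integrable M (f n)"
    and d: "\<And>n. (\<integral>\<omega>. \<bar>f (Suc n) \<omega> - f n \<omega>\<bar> \<partial>M) \<le> c * (1 / 2) ^ n"
  obtains Z where "integrable M Z" "(\<lambda>n. \<integral>\<omega>. \<bar>Z \<omega> - f n \<omega>\<bar> \<partial>M) \<longlonglongrightarrow> 0"
proof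
  define g where "g = (\<lambda>n \<omega>. f (Suc n) \<omega> - f n \<omega>)"
  have g: "integrable M (g n)" for n unfolding g_def using f by simp
  have [measurable]: "g n \<in> borel_measurable M" for n using g by auto
  have gc: "(\<integral>\<omega>. \<bar>g n \<omega>\<bar> \<partial>M) \<le> c * (1 / 2) ^ n" for n using d by (simp add: g_def)
  have geo: "summable (\<lambda>n. c * (1 / 2) ^ n :: real)" by (intro summable_mult summable_geometric) simp
  have sm: "summable (\<lambda>n. \<integral>\<omega>. \<bar>g n \<omega>\<bar> \<partial>M)"
    by (rule summable_comparison_test'[OF geo, of 0]) (use gc in auto)
  have "(\<integral>\<^sup>+ \<omega>. (\<Sum>n. ennreal \<bar>g n \<omega>\<bar>) \<partial>M) = (\<Sum>n. \<integral>\<^sup>+ \<omega>. ennreal \<bar>g n \<omega>\<bar> \<partial>M)"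
    by (rule nn_integral_suminf) simp
  also have "\<dots> = (\<Sum>n. ennreal (\<integral>\<omega>. \<bar>g n \<omega>\<bar> \<partial>M))"
    using g by (simp add: nn_integral_eq_integral)
  also have "\<dots> \<noteq> \<infinity>"
    using sm by (simp add: ennreal_suminf_neq_top)
  finally have "AE \<omega> in M. (\<Sum>n. ennreal \<bar>g n \<omega>\<bar>) \<noteq> \<infinity>"
    by (intro nn_integral_noteq_infinite) auto
  then have AEs: "AE \<omega> in M. summable (\<lambda>n. \<bar>g n \<omega>\<bar>)"
    by eventually_elim (auto intro!: summable_suminf_not_top)
  then have AEs': "AE \<omega> in M. summable (\<lambda>k. \<bar>g (k + n) \<omega>\<bar>)" for n
    by eventually_elim (subst summable_iff_shift)
  have sm': "summable (\<lambda>k. \<integral>\<omega>. \<bar>g (k + n) \<omega>\<bar> \<partial>M)" for n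
    using sm by (subst summable_iff_shift)
  let ?Z = "\<lambda>\<omega>. f 0 \<omega> + (\<Sum>n. g n \<omega>)"
  show Zi: "integrable M ?Z"
    using AEs sm by (intro Bochner_Integration.integrable_add f integrable_suminf g) auto
  have le: "(\<integral>\<omega>. \<bar>?Z \<omega> - f n \<omega>\<bar> \<partial>M) \<le> (\<Sum>k. \<integral>\<omega>. \<bar>g (k + n) \<omega>\<bar> \<partial>M)" for n
  proof -
    have i: "integrable M (\<lambda>\<omega>. \<Sum>k. \<bar>g (k + n) \<omega>\<bar>)"
      using AEs'[of n] sm'[of n] by (intro integrable_suminf integrable_abs g) auto
    have "(\<integral>\<omega>. \<bar>?Z \<omega> - f n \<omega>\<bar> \<partial>M) \<le> (\<integral>\<omega>. (\<Sum>k. \<bar>g (k + n) \<omega>\<bar>) \<partial>M)"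
    proof (rule integral_mono_AE[OF _ i])
      show "integrable M (\<lambda>\<omega>. \<bar>?Z \<omega> - f n \<omega>\<bar>)" using Zi f by simp
      show "AE \<omega> in M. \<bar>?Z \<omega> - f n \<omega>\<bar> \<le> (\<Sum>k. \<bar>g (k + n) \<omega>\<bar>)"
        using AEs AEs'[of n]
      proof eventually_elim
        case (elim \<omega>)
        have "(\<Sum>k. g k \<omega>) = (\<Sum>k. g (k + n) \<omega>) + (\<Sum>k<n. g k \<omega>)"
          by (rule suminf_split_initial_segment[OF summable_rabs_cancel[OF elim(1)]])
        moreover have "(\<Sum>k<n. g k \<omega>) = f n \<omega> - f 0 \<omega>"
          unfolding g_def by (rule sum_lessThan_telescope)
        ultimately have "?Z \<omega> - f n \<omega> = (\<Sum>k. g (k + n) \<omega>)" by simp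
        then show ?case using summable_rabs[OF elim(2)] by simp
      qed
    qed
    also have "\<dots> = (\<Sum>k. \<integral>\<omega>. \<bar>g (k + n) \<omega>\<bar> \<partial>M)"
      using AEs'[of n] sm'[of n] by (intro integral_suminf integrable_abs g) auto
    finally show ?thesis .
  qed
  show "(\<lambda>n. \<integral>\<omega>. \<bar>?Z \<omega> - f n \<omega>\<bar> \<partial>M) \<longlonglongrightarrow> 0"
    by (rule tendsto_sandwich[OF _ _ tendsto_const suminf_exist_split2[OF sm]]) (use le in auto)
qed

section \<open>Trigonometric expectations under convergence in mean\<close>

lemma abs_cos_diff_le: "\<bar>cos x - cos y\<bar> \<le> \<bar>x - y\<bar>" for x y :: real
proof -
  have "\<bar>cos x - cos y\<bar> = 2 * (\<bar>sin ((x + y) / 2)\<bar> * \<bar>sin ((y - x) / 2)\<bar>)"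
    by (simp add: cos_diff_cos abs_mult)
  also have "\<dots> \<le> 2 * (1 * \<bar>(y - x) / 2\<bar>)"
    by (intro mult_left_mono mult_mono abs_sin_le_one abs_sin_x_le_abs_x) auto
  finally show ?thesis by simp
qed

lemma abs_sin_diff_le: "\<bar>sin x - sin y\<bar> \<le> \<bar>x - y\<bar>" for x y :: real
  using abs_cos_diff_le[of "pi / 2 - x" "pi / 2 - y"] by (simp add: cos_diff abs_minus_commute)

text \<open>By the Lipschitz bound the expectations differ by at most the distance in mean. For
  cosine and sine this carries characteristic functions to the limit.\<close>

lemma (in prob_space) L1_limit_bounded_lipschitz:
  fixes g :: "real \<Rightarrow> real"
  assumes Z: "integrable M Z" "\<And>n. integrable M (Y n)"
    and lim: "(\<lambda>n::nat. expectation (\<lambda>\<omega>. \<bar>Z \<omega> - Y n \<omega>\<bar>)) \<longlonglongrightarrow> 0"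
    and gm[measurable]: "g \<in> borel_measurable borel"
    and g: "\<And>x. \<bar>g x\<bar> \<le> 1" "\<And>x y. \<bar>g x - g y\<bar> \<le> \<bar>x - y\<bar>"
  shows "(\<lambda>n. expectation (\<lambda>\<omega>. g (Y n \<omega>))) \<longlonglongrightarrow> expectation (\<lambda>\<omega>. g (Z \<omega>))"
proof -
  have [measurable]: "Z \<in> borel_measurable M" "Y n \<in> borel_measurable M" for n using Z by auto
  have gi: "integrable M (\<lambda>\<omega>. g (W \<omega>))" if [measurable]: "W \<in> borel_measurable M" for W
    by (rule integrable_const_bound[of _ 1]) (use g in auto)
  have le: "\<bar>expectation (\<lambda>\<omega>. g (Z \<omega>)) - expectation (\<lambda>\<omega>. g (Y n \<omega>))\<bar> \<le> expectation (\<lambda>\<omega>. \<bar>Z \<omega> - Y n \<omega>\<bar>)" for n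
  proof -
    have "expectation (\<lambda>\<omega>. g (Z \<omega>)) - expectation (\<lambda>\<omega>. g (Y n \<omega>)) = expectation (\<lambda>\<omega>. g (Z \<omega>) - g (Y n \<omega>))"
      by (simp add: gi)
    also have "\<bar>\<dots>\<bar> \<le> expectation (\<lambda>\<omega>. \<bar>g (Z \<omega>) - g (Y n \<omega>)\<bar>)"
      by (rule integral_abs_bound)
    also have "\<dots> \<le> expectation (\<lambda>\<omega>. \<bar>Z \<omega> - Y n \<omega>\<bar>)"
      using Z g by (intro integral_mono integrable_abs Bochner_Integration.integrable_diff gi) auto
    finally show ?thesis .
  qed
  have "(\<lambda>n. \<bar>expectation (\<lambda>\<omega>. g (Y n \<omega>)) - expectation (\<lambda>\<omega>. g (Z \<omega>))\<bar>) \<longlonglongrightarrow> 0"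
    by (rule tendsto_sandwich[OF _ _ tendsto_const lim]) (use le in \<open>auto simp: abs_minus_commute\<close>)
  then show ?thesis by (simp add: LIM_zero_iff tendsto_rabs_zero_iff)
qed

section \<open>Real vectors in the sequence space\<close>

lemma coord_sum: "coord (sum f J) i = (\<Sum>j\<in>J. coord (f j) i)"
  by (induct J rule: infinite_finite_induct) (auto simp: zero_ell2.rep_eq plus_ell2.rep_eq)

lemma norm_ell2_squared: "(norm x)\<^sup>2 = (\<Sum>\<^sub>\<infinity>i. (cmod (coord x i))\<^sup>2)"
  by (simp add: norm_ell2_def infsum_nonneg)

lemma inner_basis_vec: "inner x (basis_vec j) = Re (coord x j)"
proof -
  have "inner x (basis_vec j) = (\<Sum>\<^sub>\<infinity>i\<in>{j}. inner (coord x i) (coord (basis_vec j) i))"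
    unfolding inner_ell2_def by (rule infsum_cong_neutral) (auto simp: basis_vec.rep_eq)
  then show ?thesis by (simp add: basis_vec.rep_eq inner_complex_def)
qed

lemma norm_coord_le: "cmod (coord x i) \<le> norm x"
proof (rule power2_le_imp_le)
  have "(cmod (coord x i))\<^sup>2 = (\<Sum>i\<in>{i}. (cmod (coord x i))\<^sup>2)" by simp
  also have "\<dots> \<le> (norm x)\<^sup>2"
    unfolding norm_ell2_squared by (rule finite_sum_le_infsum) (auto simp: coord_summable)
  finally show "(cmod (coord x i))\<^sup>2 \<le> (norm x)\<^sup>2" .
qed simp

lemma bounded_linear_coord: "bounded_linear (\<lambda>x. coord x i)"
  by (rule bounded_linear_intro[of _ 1])
     (auto simp: plus_ell2.rep_eq scaleR_ell2.rep_eq scaleR_conv_of_real norm_coord_le)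

definition fin_vec :: "int set \<Rightarrow> (int \<Rightarrow> real) \<Rightarrow> ell2"
  where "fin_vec J u = (\<Sum>j\<in>J. u j *\<^sub>R basis_vec j)"

text \<open>Limits of finite combinations with real coefficients stay in this real subspace, so the
  correspondence between vectors and real random variables is confined to it.\<close>

definition real_vec :: "ell2 \<Rightarrow> bool"
  where "real_vec x \<longleftrightarrow> (\<forall>i. Im (coord x i) = 0)"

lemma coord_fin_vec:
  "finite J \<Longrightarrow> coord (fin_vec J u) i = (if i \<in> J then of_real (u i) else 0)"
  by (simp add: fin_vec_def coord_sum scaleR_ell2.rep_eq basis_vec.rep_eq if_distrib[of "(*) _"] cong: if_cong)

lemma real_vec_fin_vec: "finite J \<Longrightarrow> real_vec (fin_vec J u)"
  by (simp add: real_vec_def coord_fin_vec)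

lemma real_vec_basis_vec: "real_vec (basis_vec j)"
  by (simp add: real_vec_def basis_vec.rep_eq)

lemma inner_fin_vec: "inner x (fin_vec J u) = (\<Sum>j\<in>J. u j * Re (coord x j))"
  by (simp add: fin_vec_def inner_sum_right inner_basis_vec)

lemma real_vec_approx:
  assumes x: "real_vec x" and e: "e > 0"
  shows "\<exists>J. finite J \<and> norm (x - fin_vec J (\<lambda>j. Re (coord x j))) < e"
proof -
  let ?f = "\<lambda>i. (cmod (coord x i))\<^sup>2"
  \<comment> \<open>The approximation is only non-strict; aiming at \<open>e / 2\<close> makes the
    final inequality strict.\<close>
  obtain J where J: "finite J" "dist (sum ?f J) (infsum ?f UNIV) \<le> (e / 2)\<^sup>2"
    using infsum_finite_approximation[OF coord_summable[of x], of "(e / 2)\<^sup>2"] e by auto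
  let ?y = "fin_vec J (\<lambda>j. Re (coord x j))"
  have "(norm (x - ?y))\<^sup>2 = infsum ?f (- J)"
    unfolding norm_ell2_squared using J x
    by (intro infsum_cong_neutral) (auto simp: minus_ell2.rep_eq coord_fin_vec real_vec_def complex_eq_iff)
  also have "\<dots> = infsum ?f UNIV - sum ?f J"
    using infsum_Diff[OF coord_summable[of x] summable_on_finite[OF J(1)]] J(1)
    by (simp add: Compl_eq_Diff_UNIV)
  also have "\<dots> \<le> (e / 2)\<^sup>2" using J(2) by (simp add: dist_real_def abs_le_iff)
  finally have "norm (x - ?y) \<le> e / 2" using e by (auto intro: power2_le_imp_le)
  then show ?thesis using J e by (intro exI[of _ J]) auto
qed

section \<open>From matrix entries to the operator on real vectors\<close>

text \<open>Finite real combinations of basis vectors are dense in the real vectors. As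
  \<open>f\<close> is only real-linear, its values on imaginary multiples of basis vectors are not
  controlled, which is why \<open>x\<close> is real.\<close>

lemma functional_zero_on_real_vec:
  fixes f :: "ell2 \<Rightarrow> real"
  assumes f: "bounded_linear f" and z: "\<And>j. f (basis_vec j) = 0" and x: "real_vec x"
  shows "f x = 0"
proof (rule ccontr)
  interpret f: bounded_linear f by (rule f)
  assume "f x \<noteq> 0"
  obtain K where K: "K > 0" "\<And>x. norm (f x) \<le> norm x * K"
    using f.pos_bounded by blast
  have "\<bar>f x\<bar> / K > 0" using K \<open>f x \<noteq> 0\<close> by simp
  then obtain J where J: "norm (x - fin_vec J (\<lambda>j. Re (coord x j))) < \<bar>f x\<bar> / K"
    using real_vec_approx[OF x] by blast
  have "f (fin_vec J (\<lambda>j. Re (coord x j))) = 0"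
    by (simp add: fin_vec_def f.sum f.scaleR z)
  then have "\<bar>f x\<bar> \<le> norm (x - fin_vec J (\<lambda>j. Re (coord x j))) * K"
    using K(2)[of "x - fin_vec J (\<lambda>j. Re (coord x j))"] by (simp add: f.diff)
  also have "\<dots> < \<bar>f x\<bar>" using J K(1) by (simp add: pos_less_divide_eq)
  finally show False by simp
qed

lemma real_vec_blinfun_apply:
  assumes S: "\<And>i j. Im (matrix_entry S i j) = 0" and x: "real_vec x"
  shows "real_vec (blinfun_apply S x)"
  unfolding real_vec_def
proof
  fix i
  have "bounded_linear (\<lambda>x. Im (coord (blinfun_apply S x) i))"
    by (intro bounded_linear_compose[OF bounded_linear_Im] bounded_linear_compose[OF bounded_linear_coord]
        blinfun.bounded_linear_right)
  then show "Im (coord (blinfun_apply S x) i) = 0"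
    by (rule functional_zero_on_real_vec) (use S x in \<open>auto simp: matrix_entry_def\<close>)
qed

text \<open>Density is used once in each argument: first in \<open>x\<close> against a fixed basis
  vector, where the claim reduces to symmetry of the matrix, and then in \<open>y\<close>.\<close>

lemma self_adjoint_on_real_vec:
  assumes S: "\<And>i j. matrix_entry S i j = matrix_entry S j i" and x: "real_vec x" and y: "real_vec y"
  shows "inner (blinfun_apply S x) y = inner x (blinfun_apply S y)"
proof -
  have *: "inner (blinfun_apply S x) (basis_vec j) = inner x (blinfun_apply S (basis_vec j))" for j
  proof -
    let ?f = "\<lambda>x. inner (blinfun_apply S x) (basis_vec j) - inner x (blinfun_apply S (basis_vec j))"
    have "bounded_linear ?f"
      by (intro bounded_linear_sub bounded_linear_compose[OF bounded_linear_inner_left]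
          blinfun.bounded_linear_right bounded_linear_inner_left)
    moreover have "?f (basis_vec i) = 0" for i
      using S[of i j] by (simp add: inner_basis_vec inner_commute[of "basis_vec _"] matrix_entry_def)
    ultimately have "?f x = 0"
      using x by (rule functional_zero_on_real_vec)
    then show ?thesis by simp
  qed
  have "inner (blinfun_apply S x) y - inner x (blinfun_apply S y) = 0"
    by (rule functional_zero_on_real_vec[of "\<lambda>y. inner (blinfun_apply S x) y - inner x (blinfun_apply S y)"])
       (use * y in \<open>auto intro!: bounded_linear_intros bounded_linear_sub\<close>)
  then show ?thesis by simp
qed

text \<open>Split T x into real and imaginary parts a + i b. Complex linearity gives x = S a + i S
  b, and S a, S b are real because the matrix of \<open>S\<close> is real. As \<open>x\<close> is
  real, S b = 0, and applying \<open>T\<close> gives b = 0.\<close>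

lemma real_vec_inverse:
  assumes S: "S \<in> bounded_ops" "\<And>i j. Im (matrix_entry S i j) = 0"
    and ST: "is_inverse_op S T" and x: "real_vec x"
  shows "real_vec (blinfun_apply T x)"
proof -
  have inv: "blinfun_apply S (blinfun_apply T y) = y" "blinfun_apply T (blinfun_apply S y) = y" for y
    using ST unfolding is_inverse_op_def by (metis blinfun_apply_blinfun_compose id_blinfun.rep_eq id_apply)+
  define v where "v = blinfun_apply T x"
  define a where "a = Abs_ell2 (\<lambda>i. of_real (Re (coord v i)))"
  define b where "b = Abs_ell2 (\<lambda>i. of_real (Im (coord v i)))"
  have le: "(cmod (of_real (Re z)))\<^sup>2 \<le> (cmod z)\<^sup>2" "(cmod (of_real (Im z)))\<^sup>2 \<le> (cmod z)\<^sup>2" for z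
    by (simp_all add: cmod_power2)
  have ca: "coord a i = of_real (Re (coord v i))" and cb: "coord b i = of_real (Im (coord v i))" for i
    unfolding a_def b_def
    by (subst Abs_ell2_inverse; auto intro!: summable_on_comparison_test[OF coord_summable[of v]] le[simplified])+
  have v: "v = a + \<i> *\<^sub>C b"
    by (simp add: coord_inject[symmetric] fun_eq_iff plus_ell2.rep_eq scaleC.rep_eq ca cb complex_eq_iff)
  have "x = blinfun_apply S v" by (simp add: v_def inv)
  also have "\<dots> = blinfun_apply S a + \<i> *\<^sub>C blinfun_apply S b"
    using S(1) unfolding v bounded_ops_def by (simp add: blinfun.add_right)
  finally have xs: "coord x i = coord (blinfun_apply S a) i + \<i> * coord (blinfun_apply S b) i" for i
    by (simp add: plus_ell2.rep_eq scaleC.rep_eq)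
  have "real_vec a" "real_vec b" by (simp_all add: real_vec_def ca cb)
  then have "real_vec (blinfun_apply S a)" "real_vec (blinfun_apply S b)"
    using real_vec_blinfun_apply[of S] S(2) by auto
  then have "coord (blinfun_apply S b) i = 0" for i
    using xs[of i] x by (simp add: real_vec_def complex_eq_iff)
  then have "blinfun_apply S b = 0"
    by (simp add: coord_inject[symmetric] fun_eq_iff zero_ell2.rep_eq)
  then have "b = 0" using inv(2)[of b] by (simp add: blinfun.zero_right)
  then show ?thesis
    using cb by (simp add: real_vec_def v_def[symmetric] zero_ell2.rep_eq)
qed

section \<open>Linear functionals of a Gaussian sequence\<close>

locale gaussian_sequence = prob_space M
  for M :: "'a measure" and X :: "int \<Rightarrow> 'a \<Rightarrow> real" and S :: "ell2 \<Rightarrow>\<^sub>L ell2" +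
  assumes cov: "centered_gaussian_with_cov M X S"
begin

abbreviation lin :: "int set \<Rightarrow> (int \<Rightarrow> real) \<Rightarrow> 'a \<Rightarrow> real"
  where "lin J u \<equiv> \<lambda>\<omega>. \<Sum>j\<in>J. u j * X j \<omega>"

abbreviation Q :: "ell2 \<Rightarrow> real"
  where "Q v \<equiv> inner (blinfun_apply S v) v"

lemma X_measurable [measurable]: "X j \<in> borel_measurable M"
  using cov by (simp add: centered_gaussian_with_cov_def gaussian_process_def)

lemma lin_gaussian: "finite J \<Longrightarrow> gaussian_rv M (lin J u)"
  using cov by (simp add: centered_gaussian_with_cov_def gaussian_process_def)

lemma matrix_entry_eq: "matrix_entry S i j = of_real (expectation (\<lambda>\<omega>. X i \<omega> * X j \<omega>))"
  using cov by (simp add: centered_gaussian_with_cov_def)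

lemma matrix_entry_real: "Im (matrix_entry S i j) = 0"
  by (simp add: matrix_entry_eq)

lemma matrix_entry_sym: "matrix_entry S i j = matrix_entry S j i"
  by (simp add: matrix_entry_eq mult.commute)

lemma X_moments:
  "integrable M (X j)" "expectation (X j) = 0" "integrable M (\<lambda>\<omega>. (X j \<omega>)\<^sup>2)"
proof -
  show 0: "expectation (X j) = 0"
    using cov by (simp add: centered_gaussian_with_cov_def)
  have "gaussian_rv M (X j)" using lin_gaussian[of "{j}" "\<lambda>_. 1"] by simp
  then obtain \<sigma> where "distr M borel (X j) = distr std_normal_distribution borel (\<lambda>x. \<sigma> * x)"
    using gaussian_rv_scaled_normal[of "X j"] 0 by metis
  from scaled_normal_law[OF X_measurable this]
  show "integrable M (X j)" "integrable M (\<lambda>\<omega>. (X j \<omega>)\<^sup>2)" by auto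
qed

lemma X_mult_integrable: "integrable M (\<lambda>\<omega>. X i \<omega> * X j \<omega>)"
proof (rule Bochner_Integration.integrable_bound)
  show "integrable M (\<lambda>\<omega>. (X i \<omega>)\<^sup>2 + (X j \<omega>)\<^sup>2)" using X_moments by simp
  have "\<bar>a * b\<bar> \<le> a\<^sup>2 + b\<^sup>2" for a b :: real
    using sum_squares_bound[of "\<bar>a\<bar>" "\<bar>b\<bar>"] mult_nonneg_nonneg[of "\<bar>a\<bar>" "\<bar>b\<bar>"]
    unfolding abs_mult power2_abs by linarith
  then show "AE \<omega> in M. norm (X i \<omega> * X j \<omega>) \<le> norm ((X i \<omega>)\<^sup>2 + (X j \<omega>)\<^sup>2)"
    by (simp add: abs_of_nonneg)
qed simp

lemma lin_integrable: "integrable M (lin J u)"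
  using X_moments by simp

lemma lin_expectation_zero: "expectation (lin J u) = 0"
  using X_moments by simp

lemma lin_second_moment: "expectation (\<lambda>\<omega>. (lin J u \<omega>)\<^sup>2) = Q (fin_vec J u)"
proof -
  have "expectation (\<lambda>\<omega>. (lin J u \<omega>)\<^sup>2) =
      expectation (\<lambda>\<omega>. \<Sum>i\<in>J. \<Sum>j\<in>J. u i * u j * (X i \<omega> * X j \<omega>))"
    by (simp add: power2_eq_square sum_product mult_ac)
  also have "\<dots> = (\<Sum>i\<in>J. \<Sum>j\<in>J. u i * u j * expectation (\<lambda>\<omega>. X i \<omega> * X j \<omega>))"
    using X_mult_integrable by simp
  also have "\<dots> = (\<Sum>i\<in>J. u i * Re (coord (blinfun_apply S (fin_vec J u)) i))"
  proof (rule sum.cong[OF refl])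
    fix i
    have "Re (coord (blinfun_apply S (fin_vec J u)) i) = (\<Sum>j\<in>J. u j * Re (matrix_entry S i j))"
      by (simp add: fin_vec_def blinfun.sum_right blinfun.scaleR_right coord_sum scaleR_ell2.rep_eq matrix_entry_def)
    then show "(\<Sum>j\<in>J. u i * u j * expectation (\<lambda>\<omega>. X i \<omega> * X j \<omega>)) =
      u i * Re (coord (blinfun_apply S (fin_vec J u)) i)"
      by (simp add: sum_distrib_left matrix_entry_eq mult_ac)
  qed
  finally show ?thesis by (simp add: inner_fin_vec)
qed

lemma lin_trig:
  assumes "finite J"
  shows "expectation (\<lambda>\<omega>. cos (lin J u \<omega>)) = exp (- Q (fin_vec J u) / 2)"
    "expectation (\<lambda>\<omega>. sin (lin J u \<omega>)) = 0"
    "expectation (\<lambda>\<omega>. \<bar>lin J u \<omega>\<bar>) \<le> sqrt (Q (fin_vec J u))"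
proof -
  obtain \<sigma> where \<sigma>: "lin J u \<in> borel_measurable M"
      "distr M borel (lin J u) = distr std_normal_distribution borel (\<lambda>x. \<sigma> * x)"
    using gaussian_rv_scaled_normal[OF lin_gaussian[OF assms] lin_expectation_zero] by blast
  note law = scaled_normal_law[OF \<sigma>]
  show "expectation (\<lambda>\<omega>. cos (lin J u \<omega>)) = exp (- Q (fin_vec J u) / 2)"
    "expectation (\<lambda>\<omega>. sin (lin J u \<omega>)) = 0"
    using law(4-6) lin_second_moment[of u J] by simp_all
  show "expectation (\<lambda>\<omega>. \<bar>lin J u \<omega>\<bar>) \<le> sqrt (Q (fin_vec J u))"
    using abs_expectation_le_sqrt[OF \<sigma>(1) law(2)] lin_second_moment[of u J] by simp
qed

text \<open>The standard deviation \<open>sqrt (Q v)\<close> is at most this constant times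
  \<open>norm v\<close>; it converts distance in \<open>ell2\<close> into distance in mean.\<close>

definition C :: real where "C = sqrt (norm S)"

lemma C_nonneg: "C \<ge> 0" by (simp add: C_def)

lemma sqrt_Q_le: "sqrt (Q v) \<le> C * norm v"
proof -
  have "Q v \<le> norm (blinfun_apply S v) * norm v" by (rule norm_cauchy_schwarz)
  also have "\<dots> \<le> (norm S * norm v) * norm v"
    by (intro mult_right_mono norm_blinfun) auto
  finally have "sqrt (Q v) \<le> sqrt (norm S * (norm v)\<^sup>2)" by (simp add: power2_eq_square mult_ac)
  then show ?thesis by (simp add: C_def real_sqrt_mult)
qed

lemma lin_L1_le: "finite J \<Longrightarrow> expectation (\<lambda>\<omega>. \<bar>lin J u \<omega>\<bar>) \<le> C * norm (fin_vec J u)"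
  using lin_trig(3) sqrt_Q_le order_trans by blast

text \<open>\<open>rep v Z\<close>: the random variable \<open>Z\<close> represents the formal series \<open>\<Sum>j. v\<^sub>j X\<^sub>j\<close>.\<close>

definition rep :: "ell2 \<Rightarrow> ('a \<Rightarrow> real) \<Rightarrow> bool"
  where "rep v Z \<longleftrightarrow> integrable M Z \<and> (\<forall>e>0. \<exists>J u. finite J \<and>
    norm (v - fin_vec J u) < e \<and> expectation (\<lambda>\<omega>. \<bar>Z \<omega> - lin J u \<omega>\<bar>) < e)"

lemma rep_integrable: "rep v Z \<Longrightarrow> integrable M Z"
  by (simp add: rep_def)

lemma rep_lin: "finite J \<Longrightarrow> rep (fin_vec J u) (lin J u)"
  unfolding rep_def by (intro conjI lin_integrable allI impI exI[of _ J] exI[of _ u]) auto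

section \<open>Linear operations on represented variables\<close>

lemma rep_scale:
  assumes "rep v Z"
  shows "rep (c *\<^sub>R v) (\<lambda>\<omega>. c * Z \<omega>)"
  unfolding rep_def
proof (intro conjI allI impI)
  show "integrable M (\<lambda>\<omega>. c * Z \<omega>)" using assms by (simp add: rep_def)
  fix e :: real assume e: "e > 0"
  \<comment> \<open>The summand 1 keeps the denominator positive when \<open>c = 0\<close>.\<close>
  have d: "e / (\<bar>c\<bar> + 1) > 0" using e by simp
  obtain J u where J: "finite J" "norm (v - fin_vec J u) < e / (\<bar>c\<bar> + 1)"
      "expectation (\<lambda>\<omega>. \<bar>Z \<omega> - lin J u \<omega>\<bar>) < e / (\<bar>c\<bar> + 1)"
    using assms d unfolding rep_def by blast
  have *: "\<bar>c\<bar> * x < e" if "x < e / (\<bar>c\<bar> + 1)" "x \<ge> 0" for x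
  proof -
    have "\<bar>c\<bar> * x \<le> (\<bar>c\<bar> + 1) * x" using that by (intro mult_right_mono) auto
    also have "\<dots> < e" using that by (simp add: pos_less_divide_eq mult.commute)
    finally show ?thesis .
  qed
  have "norm (c *\<^sub>R v - fin_vec J (\<lambda>j. c * u j)) = \<bar>c\<bar> * norm (v - fin_vec J u)"
  proof -
    have "c *\<^sub>R v - fin_vec J (\<lambda>j. c * u j) = c *\<^sub>R (v - fin_vec J u)"
      by (simp add: fin_vec_def scaleR_diff_right scaleR_sum_right)
    then show ?thesis by simp
  qed
  moreover have "expectation (\<lambda>\<omega>. \<bar>c * Z \<omega> - lin J (\<lambda>j. c * u j) \<omega>\<bar>) =
      \<bar>c\<bar> * expectation (\<lambda>\<omega>. \<bar>Z \<omega> - lin J u \<omega>\<bar>)"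
  proof -
    have "\<bar>c * Z \<omega> - lin J (\<lambda>j. c * u j) \<omega>\<bar> = \<bar>c\<bar> * \<bar>Z \<omega> - lin J u \<omega>\<bar>" for \<omega>
      unfolding abs_mult[symmetric] by (simp add: right_diff_distrib sum_distrib_left mult.assoc)
    then show ?thesis by simp
  qed
  ultimately show "\<exists>J u. finite J \<and> norm (c *\<^sub>R v - fin_vec J u) < e \<and>
      expectation (\<lambda>\<omega>. \<bar>c * Z \<omega> - lin J u \<omega>\<bar>) < e"
    using J * by (intro exI[of _ J] exI[of _ "\<lambda>j. c * u j"]) simp
qed

text \<open>\<open>rep\<close> asks for the approximation of the vector and of the random variable
  with the same coefficients, so the sum must be formed for both simultaneously; the coefficients
  are extended by zero to the union of the supports.\<close>

lemma fin_vec_lin_add: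
  assumes "finite J" "finite K"
  obtains L w where "finite L" "fin_vec L w = fin_vec J u + fin_vec K v" "\<And>\<omega>. lin L w \<omega> = lin J u \<omega> + lin K v \<omega>"
proof
  let ?w = "\<lambda>j. (if j \<in> J then u j else 0) + (if j \<in> K then v j else 0)"
  show "finite (J \<union> K)" using assms by simp
  show "fin_vec (J \<union> K) ?w = fin_vec J u + fin_vec K v"
    using assms by (simp add: coord_inject[symmetric] fun_eq_iff plus_ell2.rep_eq coord_fin_vec)
  have "(\<Sum>j\<in>J \<union> K. ?w j * X j \<omega>) = (\<Sum>j\<in>J \<union> K. if j \<in> J then u j * X j \<omega> else 0)
      + (\<Sum>j\<in>J \<union> K. if j \<in> K then v j * X j \<omega> else 0)" for \<omega>
    unfolding sum.distrib[symmetric] by (intro sum.cong) (auto simp: algebra_simps)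
  then show "lin (J \<union> K) ?w \<omega> = lin J u \<omega> + lin K v \<omega>" for \<omega>
    using assms by (simp add: sum.inter_restrict[symmetric] Int_absorb1 Int_absorb2)
qed

lemma rep_add:
  assumes "rep v Z" "rep v' Z'"
  shows "rep (v + v') (\<lambda>\<omega>. Z \<omega> + Z' \<omega>)"
  unfolding rep_def
proof (intro conjI allI impI)
  have Zi: "integrable M Z" "integrable M Z'" using assms by (auto simp: rep_def)
  then show "integrable M (\<lambda>\<omega>. Z \<omega> + Z' \<omega>)" by simp
  fix e :: real assume "e > 0"
  then have e: "e / 2 > 0" by simp
  obtain J u where J: "finite J" "norm (v - fin_vec J u) < e / 2"
      "expectation (\<lambda>\<omega>. \<bar>Z \<omega> - lin J u \<omega>\<bar>) < e / 2"
    using assms(1) e unfolding rep_def by blast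
  obtain K w where K: "finite K" "norm (v' - fin_vec K w) < e / 2"
      "expectation (\<lambda>\<omega>. \<bar>Z' \<omega> - lin K w \<omega>\<bar>) < e / 2"
    using assms(2) e unfolding rep_def by blast
  obtain L x where L: "finite L" "fin_vec L x = fin_vec J u + fin_vec K w"
      "\<And>\<omega>. lin L x \<omega> = lin J u \<omega> + lin K w \<omega>"
    using fin_vec_lin_add[OF J(1) K(1)] by metis
  have "norm ((v + v') - fin_vec L x) < e"
    unfolding L(2) add_diff_add using norm_triangle_ineq[of "v - fin_vec J u" "v' - fin_vec K w"] J K by linarith
  moreover have "expectation (\<lambda>\<omega>. \<bar>(Z \<omega> + Z' \<omega>) - lin L x \<omega>\<bar>) < e"
  proof -
    have "expectation (\<lambda>\<omega>. \<bar>(Z \<omega> + Z' \<omega>) - lin L x \<omega>\<bar>) \<le>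
        expectation (\<lambda>\<omega>. \<bar>Z \<omega> - lin J u \<omega>\<bar> + \<bar>Z' \<omega> - lin K w \<omega>\<bar>)"
      unfolding L(3) using Zi lin_integrable by (intro integral_mono) auto
    also have "\<dots> = expectation (\<lambda>\<omega>. \<bar>Z \<omega> - lin J u \<omega>\<bar>) + expectation (\<lambda>\<omega>. \<bar>Z' \<omega> - lin K w \<omega>\<bar>)"
      using Zi lin_integrable by (intro Bochner_Integration.integral_add) auto
    finally show ?thesis using J K by linarith
  qed
  ultimately show "\<exists>J u. finite J \<and> norm (v + v' - fin_vec J u) < e \<and>
      expectation (\<lambda>\<omega>. \<bar>Z \<omega> + Z' \<omega> - lin J u \<omega>\<bar>) < e"
    using L(1) by blast
qed

lemma rep_diff:
  assumes "rep v Z" "rep v' Z'"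
  shows "rep (v - v') (\<lambda>\<omega>. Z \<omega> - Z' \<omega>)"
proof -
  have "rep (v + (- 1) *\<^sub>R v') (\<lambda>\<omega>. Z \<omega> + (- 1) * Z' \<omega>)"
    by (rule rep_add[OF assms(1) rep_scale[OF assms(2)]])
  then show ?thesis by simp
qed

lemma rep_sum:
  assumes "finite K" "\<And>k. k \<in> K \<Longrightarrow> rep (v k) (Z k)"
  shows "rep (\<Sum>k\<in>K. v k) (\<lambda>\<omega>. \<Sum>k\<in>K. Z k \<omega>)"
  using assms
proof (induct K rule: finite_induct)
  case empty
  show ?case using rep_lin[of "{}"] by (simp add: fin_vec_def)
next
  case (insert k K)
  have "rep (v k + (\<Sum>k\<in>K. v k)) (\<lambda>\<omega>. Z k \<omega> + (\<Sum>k\<in>K. Z k \<omega>))"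
    by (rule rep_add) (use insert in auto)
  then show ?case using insert(1,2) by simp
qed

section \<open>Law, size and existence of represented variables\<close>

lemma rep_sequence:
  assumes "rep v Z"
  obtains J u where "\<And>n. finite (J n)" "(\<lambda>n::nat. fin_vec (J n) (u n)) \<longlonglongrightarrow> v"
    "(\<lambda>n. expectation (\<lambda>\<omega>. \<bar>Z \<omega> - lin (J n) (u n) \<omega>\<bar>)) \<longlonglongrightarrow> 0"
proof -
  define P where "P = (\<lambda>n J u. finite J \<and> norm (v - fin_vec J u) < inverse (real (Suc n)) \<and>
      expectation (\<lambda>\<omega>. \<bar>Z \<omega> - lin J u \<omega>\<bar>) < inverse (real (Suc n)))"
  have "\<exists>J u. P n J u" for n
    unfolding P_def using assms[unfolded rep_def, THEN conjunct2, rule_format, of "inverse (real (Suc n))"] by simp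
  then obtain J u where "\<And>n. P n (J n) (u n)"
    by metis
  then have J: "finite (J n)" "norm (v - fin_vec (J n) (u n)) < inverse (real (Suc n))"
      "expectation (\<lambda>\<omega>. \<bar>Z \<omega> - lin (J n) (u n) \<omega>\<bar>) < inverse (real (Suc n))" for n
    by (auto simp: P_def)
  have "(\<lambda>n. norm (fin_vec (J n) (u n) - v)) \<longlonglongrightarrow> 0"
    by (rule tendsto_sandwich[OF _ _ tendsto_const LIMSEQ_inverse_real_of_nat])
       (use J(2) in \<open>auto simp: norm_minus_commute less_imp_le\<close>)
  then have "(\<lambda>n. fin_vec (J n) (u n)) \<longlonglongrightarrow> v"
    by (simp add: LIM_zero_iff tendsto_norm_zero_iff)
  moreover have "(\<lambda>n. expectation (\<lambda>\<omega>. \<bar>Z \<omega> - lin (J n) (u n) \<omega>\<bar>)) \<longlonglongrightarrow> 0"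
    by (rule tendsto_sandwich[OF _ _ tendsto_const LIMSEQ_inverse_real_of_nat])
       (use J(3) in \<open>auto simp: less_imp_le\<close>)
  ultimately show ?thesis using that J(1) by blast
qed

text \<open>Along an approximating sequence the trigonometric expectations converge by their
  Lipschitz property, and \<open>Q\<close> is continuous because \<open>S\<close> is bounded, so the
  formulas for finite combinations survive in the limit.\<close>

lemma rep_trig:
  assumes "rep v Z"
  shows "expectation (\<lambda>\<omega>. cos (Z \<omega>)) = exp (- Q v / 2)" "expectation (\<lambda>\<omega>. sin (Z \<omega>)) = 0"
proof -
  obtain J u where J: "\<And>n. finite (J n)" "(\<lambda>n::nat. fin_vec (J n) (u n)) \<longlonglongrightarrow> v"
    "(\<lambda>n. expectation (\<lambda>\<omega>. \<bar>Z \<omega> - lin (J n) (u n) \<omega>\<bar>)) \<longlonglongrightarrow> 0"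
    using rep_sequence[OF assms] by blast
  note lim = L1_limit_bounded_lipschitz[OF rep_integrable[OF assms] lin_integrable J(3)]
  have "(\<lambda>n. exp (- Q (fin_vec (J n) (u n)) / 2)) \<longlonglongrightarrow> expectation (\<lambda>\<omega>. cos (Z \<omega>))"
    using lim[of cos] by (simp add: lin_trig[OF J(1)] abs_cos_diff_le)
  moreover have "(\<lambda>n. exp (- Q (fin_vec (J n) (u n)) / 2)) \<longlonglongrightarrow> exp (- Q v / 2)"
    by (intro tendsto_intros J(2)) auto
  ultimately show "expectation (\<lambda>\<omega>. cos (Z \<omega>)) = exp (- Q v / 2)"
    by (rule LIMSEQ_unique)
  show "expectation (\<lambda>\<omega>. sin (Z \<omega>)) = 0"
    using lim[of sin] by (simp add: lin_trig[OF J(1)] abs_sin_diff_le LIMSEQ_const_iff)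
qed

text \<open>Combined with \<open>rep_diff\<close>, this bounds the distance in mean of two
  represented variables by the \<open>ell2\<close> distance of their vectors. It supplies the Cauchy
  estimate in \<open>rep_exists\<close> and the error bound in
  \<open>remote_past_trivial\<close>.\<close>

lemma rep_L1_le:
  assumes "rep v Z"
  shows "expectation (\<lambda>\<omega>. \<bar>Z \<omega>\<bar>) \<le> C * norm v"
proof -
  obtain J u where J: "\<And>n. finite (J n)" "(\<lambda>n::nat. fin_vec (J n) (u n)) \<longlonglongrightarrow> v"
    "(\<lambda>n. expectation (\<lambda>\<omega>. \<bar>Z \<omega> - lin (J n) (u n) \<omega>\<bar>)) \<longlonglongrightarrow> 0"
    using rep_sequence[OF assms] by blast
  note Zi = rep_integrable[OF assms]
  have "expectation (\<lambda>\<omega>. \<bar>Z \<omega>\<bar>) \<le> expectation (\<lambda>\<omega>. \<bar>Z \<omega> - lin (J n) (u n) \<omega>\<bar>) + C * norm (fin_vec (J n) (u n))" for n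
  proof -
    have "expectation (\<lambda>\<omega>. \<bar>Z \<omega>\<bar>) \<le> expectation (\<lambda>\<omega>. \<bar>Z \<omega> - lin (J n) (u n) \<omega>\<bar> + \<bar>lin (J n) (u n) \<omega>\<bar>)"
      using Zi lin_integrable by (intro integral_mono) auto
    also have "\<dots> = expectation (\<lambda>\<omega>. \<bar>Z \<omega> - lin (J n) (u n) \<omega>\<bar>) + expectation (\<lambda>\<omega>. \<bar>lin (J n) (u n) \<omega>\<bar>)"
      using Zi lin_integrable by (intro Bochner_Integration.integral_add) auto
    finally show ?thesis using lin_L1_le[OF J(1)[of n], of "u n"] by linarith
  qed
  moreover have "(\<lambda>n. expectation (\<lambda>\<omega>. \<bar>Z \<omega> - lin (J n) (u n) \<omega>\<bar>) + C * norm (fin_vec (J n) (u n))) \<longlonglongrightarrow> 0 + C * norm v"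
    by (intro tendsto_intros J)
  ultimately show ?thesis
    by (intro LIMSEQ_le_const[of _ "C * norm v"]) auto
qed

text \<open>Truncations of \<open>v\<close> with error below \<open>(1 / 2) ^ n\<close> yield finite
  combinations whose increments decrease geometrically in mean, so completeness provides the
  limit.\<close>

lemma rep_exists:
  assumes v: "real_vec v"
  obtains Z where "rep v Z"
proof -
  let ?u = "\<lambda>j. Re (coord v j)"
  have "\<exists>J. finite J \<and> norm (v - fin_vec J ?u) < (1 / 2) ^ n" for n :: nat
    by (rule real_vec_approx[OF v]) simp
  then have "\<exists>J. \<forall>n::nat. finite (J n) \<and> norm (v - fin_vec (J n) ?u) < (1 / 2) ^ n"
    by (intro choice allI)
  then obtain J where J: "\<And>n::nat. finite (J n)" "\<And>n. norm (v - fin_vec (J n) ?u) < (1 / 2) ^ n"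
    by blast
  \<comment> \<open>Both truncations are compared with \<open>v\<close>, and the error at
    \<open>Suc n\<close> is weakened to the one at \<open>n\<close>; this is the factor 2.\<close>
  have d: "expectation (\<lambda>\<omega>. \<bar>lin (J (Suc n)) ?u \<omega> - lin (J n) ?u \<omega>\<bar>) \<le> (C * 2) * (1 / 2) ^ n" for n
  proof -
    have "expectation (\<lambda>\<omega>. \<bar>lin (J (Suc n)) ?u \<omega> - lin (J n) ?u \<omega>\<bar>)
        \<le> C * norm (fin_vec (J (Suc n)) ?u - fin_vec (J n) ?u)"
      by (intro rep_L1_le rep_diff rep_lin J)
    also have "\<dots> \<le> C * (2 * (1 / 2) ^ n)"
    proof (intro mult_left_mono C_nonneg)
      have "norm (fin_vec (J (Suc n)) ?u - fin_vec (J n) ?u) \<le>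
          norm (v - fin_vec (J n) ?u) + norm (v - fin_vec (J (Suc n)) ?u)"
        using norm_triangle_ineq4[of "v - fin_vec (J n) ?u" "v - fin_vec (J (Suc n)) ?u"] by simp
      also have "\<dots> \<le> 2 * (1 / 2) ^ n"
      proof -
        have "(1 / 2 :: real) ^ Suc n \<le> (1 / 2) ^ n" by (rule power_decreasing) auto
        then show ?thesis using J(2)[of n] J(2)[of "Suc n"] by linarith
      qed
      finally show "norm (fin_vec (J (Suc n)) ?u - fin_vec (J n) ?u) \<le> 2 * (1 / 2) ^ n" .
    qed
    finally show ?thesis by simp
  qed
  obtain Z where Z: "integrable M Z" "(\<lambda>n. expectation (\<lambda>\<omega>. \<bar>Z \<omega> - lin (J n) ?u \<omega>\<bar>)) \<longlonglongrightarrow> 0"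
    by (rule L1_complete_geometric[of M "\<lambda>n. lin (J n) ?u", OF lin_integrable d])
  have "rep v Z"
    unfolding rep_def
  proof (intro conjI allI impI Z)
    fix e :: real assume e: "e > 0"
    have "\<forall>\<^sub>F n in sequentially. expectation (\<lambda>\<omega>. \<bar>Z \<omega> - lin (J n) ?u \<omega>\<bar>) < e"
      using order_tendstoD(2)[OF Z(2) e] .
    moreover have "\<forall>\<^sub>F n in sequentially. (1 / 2 :: real) ^ n < e"
      using order_tendstoD(2)[OF LIMSEQ_realpow_zero[of "1 / 2 :: real"] e] by simp
    ultimately have "\<forall>\<^sub>F n in sequentially. expectation (\<lambda>\<omega>. \<bar>Z \<omega> - lin (J n) ?u \<omega>\<bar>) < e \<and> (1 / 2 :: real) ^ n < e"
      by (rule eventually_conj)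
    then obtain n where "expectation (\<lambda>\<omega>. \<bar>Z \<omega> - lin (J n) ?u \<omega>\<bar>) < e" "(1 / 2 :: real) ^ n < e"
      using eventually_happens'[OF sequentially_bot] by blast
    then show "\<exists>J u. finite J \<and> norm (v - fin_vec J u) < e \<and> expectation (\<lambda>\<omega>. \<bar>Z \<omega> - lin J u \<omega>\<bar>) < e"
      using J[of n] by (intro exI[of _ "J n"] exI[of _ ?u]) auto
  qed
  then show ?thesis by (rule that)
qed

text \<open>The multiple s Z represents s v, and Q (s v) = s^2 Q v, so \<open>rep_trig\<close>
  yields the whole characteristic function of \<open>Z\<close>.\<close>

lemma rep_law:
  assumes Z: "rep v Z"
  shows "Q v \<ge> 0" "distr M borel Z = distr std_normal_distribution borel (\<lambda>x. sqrt (Q v) * x)"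
proof -
  have Zm: "Z \<in> borel_measurable M" using rep_integrable[OF Z] by auto
  have "expectation (\<lambda>\<omega>. cos (s * Z \<omega>)) = exp (- (s\<^sup>2 * Q v) / 2)" for s
    using rep_trig(1)[OF rep_scale[OF Z, of s]]
    by (simp add: blinfun.scaleR_right power2_eq_square mult.assoc)
  moreover have "expectation (\<lambda>\<omega>. sin (s * Z \<omega>)) = 0" for s
    using rep_trig(2)[OF rep_scale[OF Z, of s]] .
  ultimately show "Q v \<ge> 0" "distr M borel Z = distr std_normal_distribution borel (\<lambda>x. sqrt (Q v) * x)"
    using scaled_normal_if_trig[OF Zm, of "Q v"] by auto
qed

lemma rep_moments:
  assumes Z: "rep v Z"
  shows "expectation Z = 0" "integrable M (\<lambda>\<omega>. (Z \<omega>)\<^sup>2)" "expectation (\<lambda>\<omega>. (Z \<omega>)\<^sup>2) = Q v"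
proof -
  have Zm: "Z \<in> borel_measurable M" using rep_integrable[OF Z] by auto
  show "expectation Z = 0" "integrable M (\<lambda>\<omega>. (Z \<omega>)\<^sup>2)" "expectation (\<lambda>\<omega>. (Z \<omega>)\<^sup>2) = Q v"
    using scaled_normal_law[OF Zm rep_law(2)[OF Z]] rep_law(1)[OF Z] by auto
qed

end

section \<open>The dual process\<close>

locale invertible_gaussian_sequence = gaussian_sequence +
  fixes T :: "ell2 \<Rightarrow>\<^sub>L ell2"
  assumes S_ops: "S \<in> bounded_ops" and inverse: "is_inverse_op S T"
begin

lemma inverse_apply [simp]:
  "blinfun_apply S (blinfun_apply T v) = v" "blinfun_apply T (blinfun_apply S v) = v"
  using inverse unfolding is_inverse_op_def
  by (metis blinfun_apply_blinfun_compose id_blinfun.rep_eq id_apply)+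

lemma real_vec_S: "real_vec v \<Longrightarrow> real_vec (blinfun_apply S v)"
  by (rule real_vec_blinfun_apply[OF matrix_entry_real])

lemma real_vec_T: "real_vec v \<Longrightarrow> real_vec (blinfun_apply T v)"
  by (rule real_vec_inverse[OF S_ops matrix_entry_real inverse])

lemma S_self_adjoint:
  "real_vec v \<Longrightarrow> real_vec w \<Longrightarrow> inner (blinfun_apply S v) w = inner v (blinfun_apply S w)"
  by (rule self_adjoint_on_real_vec[OF matrix_entry_sym])

text \<open>By \<open>rep_L1_le\<close> applied to a difference, a vector determines its
  representing variable up to a null set, so an arbitrary choice is harmless.\<close>

definition Y :: "int \<Rightarrow> 'a \<Rightarrow> real"
  where "Y k = (SOME Z. rep (blinfun_apply T (basis_vec k)) Z)"

lemma rep_Y: "rep (blinfun_apply T (basis_vec k)) (Y k)"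
proof -
  obtain Z where "rep (blinfun_apply T (basis_vec k)) Z"
    using rep_exists[OF real_vec_T[OF real_vec_basis_vec]] by blast
  then show ?thesis unfolding Y_def by (rule someI[where P = "rep (blinfun_apply T (basis_vec k))"])
qed

lemma rep_Y_sum:
  assumes "finite K"
  shows "rep (blinfun_apply T (fin_vec K c)) (\<lambda>\<omega>. \<Sum>k\<in>K. c k * Y k \<omega>)"
proof -
  have "rep (\<Sum>k\<in>K. c k *\<^sub>R blinfun_apply T (basis_vec k)) (\<lambda>\<omega>. \<Sum>k\<in>K. c k * Y k \<omega>)"
    by (intro rep_sum[OF assms] rep_scale rep_Y)
  then show ?thesis by (simp add: fin_vec_def blinfun.sum_right blinfun.scaleR_right)
qed

text \<open>No mixed term appears because \<open>inner (S (T c)) u = inner c u\<close> vanishes for disjoint supports.\<close>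

lemma Q_dual_orthogonal:
  assumes "finite K" "finite J" "K \<inter> J = {}"
  shows "Q (blinfun_apply T (fin_vec K c) + s *\<^sub>R fin_vec J u) =
    Q (blinfun_apply T (fin_vec K c)) + s\<^sup>2 * Q (fin_vec J u)"
proof -
  let ?v = "fin_vec K c" and ?w = "fin_vec J u"
  have "inner ?v ?w = (\<Sum>j\<in>J. u j * Re (coord ?v j))" by (rule inner_fin_vec)
  also have "\<dots> = 0"
    using assms by (intro sum.neutral) (auto simp: coord_fin_vec)
  finally have 1: "inner ?v ?w = 0" .
  have "inner (blinfun_apply S ?w) (blinfun_apply T ?v) = inner ?w ?v"
    using assms by (subst S_self_adjoint) (auto simp: real_vec_fin_vec real_vec_T)
  then have 2: "inner (blinfun_apply S ?w) (blinfun_apply T ?v) = 0"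
    using 1 by (simp add: inner_commute)
  show ?thesis
    by (simp add: blinfun.add_right blinfun.scaleR_right inner_add_left inner_add_right 1 2 power2_eq_square)
qed

text \<open>The product-to-sum formulas leave the sum and the difference of V and
  \<open>lin J u\<close>. Their cosine expectations agree, since the sign enters
  \<open>Q_dual_orthogonal\<close> only through its square, and their sine expectations vanish; the
  exponential of the added variances then factors. Together the four identities express independence
  of the two variables.\<close>

lemma dual_trig_product:
  fixes K J :: "int set" and c u :: "int \<Rightarrow> real"
  assumes K: "finite K" and J: "finite J" and disj: "K \<inter> J = {}"
  defines "V \<equiv> \<lambda>\<omega>. \<Sum>k\<in>K. c k * Y k \<omega>"
  shows "expectation (\<lambda>\<omega>. cos (V \<omega>) * cos (lin J u \<omega>)) =
      expectation (\<lambda>\<omega>. cos (V \<omega>)) * expectation (\<lambda>\<omega>. cos (lin J u \<omega>))"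
    "expectation (\<lambda>\<omega>. cos (V \<omega>) * sin (lin J u \<omega>)) = 0"
    "expectation (\<lambda>\<omega>. sin (V \<omega>) * cos (lin J u \<omega>)) = 0"
    "expectation (\<lambda>\<omega>. sin (V \<omega>) * sin (lin J u \<omega>)) = 0"
proof -
  let ?v = "blinfun_apply T (fin_vec K c)" and ?w = "fin_vec J u"
  have V: "rep ?v V" unfolding V_def by (rule rep_Y_sum[OF K])
  have p: "rep (?v + s *\<^sub>R ?w) (\<lambda>\<omega>. V \<omega> + s * lin J u \<omega>)" for s
    by (intro rep_add V rep_scale rep_lin J)
  have [measurable]: "V \<in> borel_measurable M" using rep_integrable[OF V] by auto
  define W where "W = (\<lambda>s \<omega>. V \<omega> + s * lin J u \<omega>)"
  have [measurable]: "W s \<in> borel_measurable M" for s unfolding W_def by measurable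
  have c: "expectation (\<lambda>\<omega>. cos (W s \<omega>)) = exp (- (Q ?v + s\<^sup>2 * Q ?w) / 2)"
    and z: "expectation (\<lambda>\<omega>. sin (W s \<omega>)) = 0" for s
    unfolding W_def using rep_trig[OF p[of s]] Q_dual_orthogonal[OF K J disj] by simp_all
  have ci: "integrable M (\<lambda>\<omega>. cos (W s \<omega>))" and si: "integrable M (\<lambda>\<omega>. sin (W s \<omega>))" for s
    by (rule integrable_const_bound[of _ 1]; simp)+
  have e: "cos (V \<omega>) * cos (lin J u \<omega>) = (cos (W 1 \<omega>) + cos (W (- 1) \<omega>)) / 2"
    "cos (V \<omega>) * sin (lin J u \<omega>) = (sin (W 1 \<omega>) - sin (W (- 1) \<omega>)) / 2"
    "sin (V \<omega>) * cos (lin J u \<omega>) = (sin (W 1 \<omega>) + sin (W (- 1) \<omega>)) / 2"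
    "sin (V \<omega>) * sin (lin J u \<omega>) = (cos (W (- 1) \<omega>) - cos (W 1 \<omega>)) / 2" for \<omega>
    by (simp_all add: W_def cos_add sin_add cos_diff sin_diff)
  show "expectation (\<lambda>\<omega>. cos (V \<omega>) * sin (lin J u \<omega>)) = 0"
    "expectation (\<lambda>\<omega>. sin (V \<omega>) * cos (lin J u \<omega>)) = 0"
    "expectation (\<lambda>\<omega>. sin (V \<omega>) * sin (lin J u \<omega>)) = 0"
    unfolding e by (simp_all add: ci si c z)
  have "expectation (\<lambda>\<omega>. cos (V \<omega>) * cos (lin J u \<omega>)) = exp (- (Q ?v + Q ?w) / 2)"
    unfolding e by (simp add: ci c)
  also have "\<dots> = exp (- Q ?v / 2) * exp (- Q ?w / 2)"
    unfolding exp_add[symmetric] by (simp add: field_simps)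
  finally show "expectation (\<lambda>\<omega>. cos (V \<omega>) * cos (lin J u \<omega>)) =
      expectation (\<lambda>\<omega>. cos (V \<omega>)) * expectation (\<lambda>\<omega>. cos (lin J u \<omega>))"
    unfolding rep_trig(1)[OF V] lin_trig(1)[OF J] .
qed

text \<open>By \<open>orth\<close>, which \<open>dual_trig_product\<close> provides for cosine and
  sine, the centred variable \<open>g (V \<omega>) - m\<close> is orthogonal to all trigonometric
  functions of the \<open>X j\<close> with \<open>j \<in> I\<close>, hence to the indicator of
  \<open>A\<close>. The centring is then moved to the indicator, the form in which a remote event is
  tested.\<close>

lemma dual_uncorrelated_with_past:
  fixes K :: "int set" and c :: "int \<Rightarrow> real" and g :: "real \<Rightarrow> real"
  assumes K: "finite K" "K \<inter> I = {}" and A: "A \<in> generated_events M X I"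
    and gm[measurable]: "g \<in> borel_measurable borel" and g: "\<And>x. \<bar>g x\<bar> \<le> 1"
  defines "V \<equiv> \<lambda>\<omega>. \<Sum>k\<in>K. c k * Y k \<omega>"
  assumes orth: "\<And>J u. finite J \<Longrightarrow> K \<inter> J = {} \<Longrightarrow>
      expectation (\<lambda>\<omega>. g (V \<omega>) * cos (lin J u \<omega>)) = expectation (\<lambda>\<omega>. g (V \<omega>)) * expectation (\<lambda>\<omega>. cos (lin J u \<omega>))"
    "\<And>J u. finite J \<Longrightarrow> K \<inter> J = {} \<Longrightarrow> expectation (\<lambda>\<omega>. g (V \<omega>) * sin (lin J u \<omega>)) = 0"
  shows "expectation (\<lambda>\<omega>. (indicator A \<omega> - prob A) * g (V \<omega>)) = 0"
proof -
  define m where "m = expectation (\<lambda>\<omega>. g (V \<omega>))"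
  have V: "rep (blinfun_apply T (fin_vec K c)) V" unfolding V_def by (rule rep_Y_sum[OF K(1)])
  have [measurable]: "V \<in> borel_measurable M" using rep_integrable[OF V] by auto
  have [measurable]: "A \<in> sets M" using generated_events_sets[of I X] A by auto
  have bi: "integrable M (\<lambda>\<omega>. g (V \<omega>) * f \<omega>)" "integrable M f"
    if [measurable]: "f \<in> borel_measurable M" and "\<And>\<omega>. \<bar>f \<omega>\<bar> \<le> 1" for f
    using integrable_bounded_mult[of "\<lambda>\<omega>. g (V \<omega>)" f] integrable_bounded_mult[of "\<lambda>_. 1" f] that g by auto
  have m: "\<bar>m\<bar> \<le> 1"
  proof -
    have "\<bar>m\<bar> \<le> expectation (\<lambda>\<omega>. \<bar>g (V \<omega>)\<bar>)" unfolding m_def by (rule integral_abs_bound)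
    also have "\<dots> \<le> expectation (\<lambda>_. 1)"
      using bi(1)[of "\<lambda>_. 1"] g by (intro integral_mono) auto
    finally show ?thesis by (simp add: prob_space)
  qed
  have eq: "expectation (\<lambda>\<omega>. (g (V \<omega>) - m) / 2 * f \<omega>) =
      (expectation (\<lambda>\<omega>. g (V \<omega>) * f \<omega>) - m * expectation f) / 2"
    if "f \<in> borel_measurable M" and "\<And>\<omega>. \<bar>f \<omega>\<bar> \<le> 1" for f
    using bi[OF that] by (simp add: left_diff_distrib)
  \<comment> \<open>Centring may double the bound; halving restores it to 1.\<close>
  have "trig_orthogonal X I (\<lambda>\<omega>. (g (V \<omega>) - m) / 2)"
    unfolding trig_orthogonal_def
  proof (intro conjI allI impI)
    show "\<bar>(g (V \<omega>) - m) / 2\<bar> \<le> 1" for \<omega>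
      using abs_triangle_ineq4[of "g (V \<omega>)" m] m g[of "V \<omega>"] by simp
    fix J :: "int set" and u :: "int \<Rightarrow> real" assume J: "finite J" "J \<subseteq> I"
    then have KJ: "K \<inter> J = {}" using K by auto
    show "expectation (\<lambda>\<omega>. (g (V \<omega>) - m) / 2 * cos (lin J u \<omega>)) = 0"
      by (subst eq) (simp_all add: orth(1)[OF J(1) KJ] m_def)
    show "expectation (\<lambda>\<omega>. (g (V \<omega>) - m) / 2 * sin (lin J u \<omega>)) = 0"
      by (subst eq) (simp_all add: orth(2)[OF J(1) KJ] lin_trig J)
  qed simp
  then have "expectation (\<lambda>\<omega>. (g (V \<omega>) - m) / 2 * indicator A \<omega>) = 0"
    by (rule trig_orthogonal_expectation_indicator[of I X, rotated 2]) (use A in auto)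
  then have "expectation (\<lambda>\<omega>. g (V \<omega>) * indicator A \<omega>) = m * prob A"
    by (subst (asm) eq) (auto split: split_indicator)
  moreover have "expectation (\<lambda>\<omega>. (indicator A \<omega> - prob A) * g (V \<omega>)) =
      expectation (\<lambda>\<omega>. g (V \<omega>) * indicator A \<omega> - prob A * g (V \<omega>))"
    by (simp add: algebra_simps)
  ultimately show ?thesis
    using bi(1)[of "\<lambda>_. 1"] bi(1)[of "indicator A"] by (simp add: m_def)
qed

section \<open>Triviality of the remote past\<close>

lemma remote_past_trivial:
  assumes A: "A \<in> remote_past M X"
  shows "prob A = 0 \<or> prob A = 1"
proof -
  have past: "A \<in> generated_events M X {..t}" for t using A by (auto simp: remote_past_def)
  then have AU: "A \<in> generated_events M X UNIV" using generated_events_mono by blast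
  have [measurable]: "A \<in> sets M" using generated_events_sets[of UNIV X] AU by auto
  define h where "h = (\<lambda>\<omega>. indicator A \<omega> - prob A :: real)"
  have [measurable]: "h \<in> borel_measurable M" unfolding h_def by measurable
  have hb: "\<bar>h \<omega>\<bar> \<le> 1" for \<omega>
    unfolding h_def using prob_le_1[of A] measure_nonneg[of M A] by (auto split: split_indicator)
  have h_dual: "expectation (\<lambda>\<omega>. h \<omega> * cos (\<Sum>k\<in>K. c k * Y k \<omega>)) = 0"
      "expectation (\<lambda>\<omega>. h \<omega> * sin (\<Sum>k\<in>K. c k * Y k \<omega>)) = 0" if K: "finite K" for K c
  proof -
    \<comment> \<open>Since \<open>A\<close> lies in every past, the cutoff may be placed below all
      indices of \<open>K\<close>. The empty \<open>K\<close> is treated apart, as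
      \<open>Min\<close> is meaningless there, and any cutoff serves.\<close>
    obtain t where "K \<inter> {..t} = {}"
    proof (cases "K = {}")
      case False
      have "K \<inter> {..Min K - 1} = {}" using Min_le[OF K] by fastforce
      then show ?thesis by (rule that)
    qed (simp add: that)
    note u = dual_uncorrelated_with_past[OF K this past]
    show "expectation (\<lambda>\<omega>. h \<omega> * cos (\<Sum>k\<in>K. c k * Y k \<omega>)) = 0"
      unfolding h_def by (rule u[of cos]) (auto simp: dual_trig_product[OF K])
    show "expectation (\<lambda>\<omega>. h \<omega> * sin (\<Sum>k\<in>K. c k * Y k \<omega>)) = 0"
      unfolding h_def by (rule u[of sin]) (auto simp: dual_trig_product[OF K] rep_trig(2)[OF rep_Y_sum[OF K]])
  qed
  \<comment> \<open>Transfer from dual variables to the \<open>X j\<close>, with cosine and sine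
    treated at once: a nonzero expectation would contradict \<open>z\<close> for a combination of
    the \<open>Y k\<close> close enough in mean.\<close>
  have h_lin: "expectation (\<lambda>\<omega>. h \<omega> * g (lin J u \<omega>)) = 0"
    if J: "finite J" and g: "\<And>x. \<bar>g x\<bar> \<le> 1" "\<And>x y. \<bar>g x - g y\<bar> \<le> \<bar>x - y\<bar>"
      and [measurable]: "g \<in> borel_measurable borel"
      and z: "\<And>K c. finite K \<Longrightarrow> expectation (\<lambda>\<omega>. h \<omega> * g (\<Sum>k\<in>K. c k * Y k \<omega>)) = 0"
    for J u and g :: "real \<Rightarrow> real"
  proof (rule ccontr)
    let ?d = "expectation (\<lambda>\<omega>. h \<omega> * g (lin J u \<omega>))"
    assume d: "?d \<noteq> 0"
    \<comment> \<open>\<open>C * norm T\<close> bounds the error in mean per unit of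
      \<open>ell2\<close> error in truncating \<open>?w\<close>; the added 1 makes the constant
      positive.\<close>
    let ?B = "C * norm T + 1"
    \<comment> \<open>Because T (S u) = u, the entries of S u are the coefficients of
      \<open>lin J u\<close> in the dual variables, and truncating them gives the
      approximation.\<close>
    let ?w = "blinfun_apply S (fin_vec J u)"
    have B: "?B > 0" using C_nonneg by (simp add: add_nonneg_pos)
    then have "\<bar>?d\<bar> / ?B > 0" using d by simp
    moreover have "real_vec ?w" by (intro real_vec_S real_vec_fin_vec J)
    ultimately obtain K where K: "finite K" "norm (?w - fin_vec K (\<lambda>j. Re (coord ?w j))) < \<bar>?d\<bar> / ?B"
      using real_vec_approx by blast
    define c where "c = (\<lambda>j. Re (coord ?w j))"
    define V where "V = (\<lambda>\<omega>. \<Sum>k\<in>K. c k * Y k \<omega>)"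
    have V: "rep (blinfun_apply T (fin_vec K c)) V" unfolding V_def by (rule rep_Y_sum[OF K(1)])
    have Vi: "integrable M V" by (rule rep_integrable[OF V])
    then have [measurable]: "V \<in> borel_measurable M" by auto
    have i: "integrable M (\<lambda>\<omega>. h \<omega> * g (W \<omega>))" if [measurable]: "W \<in> borel_measurable M" for W
      using hb g by (intro integrable_bounded_mult) auto
    have le: "\<bar>h \<omega> * (g (lin J u \<omega>) - g (V \<omega>))\<bar> \<le> \<bar>lin J u \<omega> - V \<omega>\<bar>" for \<omega>
      using mult_mono[OF hb[of \<omega>] g(2)[of "lin J u \<omega>" "V \<omega>"]] by (simp add: abs_mult)
    have "?d = expectation (\<lambda>\<omega>. h \<omega> * g (lin J u \<omega>)) - expectation (\<lambda>\<omega>. h \<omega> * g (V \<omega>))"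
      using z[OF K(1)] by (simp add: V_def)
    also have "\<dots> = expectation (\<lambda>\<omega>. h \<omega> * g (lin J u \<omega>) - h \<omega> * g (V \<omega>))"
      by (rule Bochner_Integration.integral_diff[symmetric]; rule i) measurable
    also have "\<dots> = expectation (\<lambda>\<omega>. h \<omega> * (g (lin J u \<omega>) - g (V \<omega>)))"
      by (simp add: right_diff_distrib)
    also have "\<bar>\<dots>\<bar> \<le> expectation (\<lambda>\<omega>. \<bar>h \<omega> * (g (lin J u \<omega>) - g (V \<omega>))\<bar>)"
      by (rule integral_abs_bound)
    also have "\<dots> \<le> expectation (\<lambda>\<omega>. \<bar>lin J u \<omega> - V \<omega>\<bar>)"
    proof (rule integral_mono)
      show "integrable M (\<lambda>\<omega>. \<bar>lin J u \<omega> - V \<omega>\<bar>)"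
        by (intro integrable_abs Bochner_Integration.integrable_diff lin_integrable Vi)
      then show "integrable M (\<lambda>\<omega>. \<bar>h \<omega> * (g (lin J u \<omega>) - g (V \<omega>))\<bar>)"
        by (rule Bochner_Integration.integrable_bound) (use le in auto)
    qed (rule le)
    also have "\<dots> \<le> C * norm (fin_vec J u - blinfun_apply T (fin_vec K c))"
      by (intro rep_L1_le rep_diff rep_lin J V)
    also have "\<dots> = C * norm (blinfun_apply T (?w - fin_vec K c))"
      by (simp add: blinfun.diff_right)
    also have "\<dots> \<le> C * (norm T * norm (?w - fin_vec K c))"
      by (intro mult_left_mono C_nonneg norm_blinfun)
    also have "\<dots> \<le> ?B * norm (?w - fin_vec K c)"
      by (simp add: distrib_right)
    also have "\<dots> < \<bar>?d\<bar>"
      using K(2) B by (simp add: c_def pos_less_divide_eq mult.commute)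
    finally show False by simp
  qed
  have "trig_orthogonal X UNIV h"
    unfolding trig_orthogonal_def
    by (intro conjI allI impI h_lin hb h_dual abs_cos_le_one abs_sin_le_one abs_cos_diff_le abs_sin_diff_le) simp_all
  then have "expectation (\<lambda>\<omega>. h \<omega> * indicator A \<omega>) = 0"
    by (rule trig_orthogonal_expectation_indicator[of UNIV X, rotated 2]) (use AU in auto)
  \<comment> \<open>On \<open>A\<close> the function \<open>h\<close> equals 1 - P(A), so the
    vanishing expectation is (1 - P(A)) P(A).\<close>
  also have "expectation (\<lambda>\<omega>. h \<omega> * indicator A \<omega>) = expectation (\<lambda>\<omega>. (1 - prob A) * indicator A \<omega>)"
    unfolding h_def by (intro Bochner_Integration.integral_cong) (auto split: split_indicator)
  finally show ?thesis by auto
qed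

section \<open>A process with covariance matrix \<open>T\<close>\<close>

lemma expectation_Y_mult:
  "matrix_entry T i j = of_real (expectation (\<lambda>\<omega>. Y i \<omega> * Y j \<omega>))"
proof -
  let ?b = "\<lambda>k. blinfun_apply T (basis_vec k)"
  note rY = rep_Y[of i] rep_Y[of j]
  \<comment> \<open>Polarization reduces the mixed moment to second moments of represented
    variables, which \<open>rep_moments\<close> evaluates.\<close>
  have "(\<lambda>\<omega>. Y i \<omega> * Y j \<omega>) = (\<lambda>\<omega>. ((Y i \<omega> + Y j \<omega>)\<^sup>2 - (Y i \<omega>)\<^sup>2 - (Y j \<omega>)\<^sup>2) / 2)"
    by (simp add: power2_sum)
  then have "expectation (\<lambda>\<omega>. Y i \<omega> * Y j \<omega>) = (Q (?b i + ?b j) - Q (?b i) - Q (?b j)) / 2"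
    using rep_moments[OF rY(1)] rep_moments[OF rY(2)] rep_moments[OF rep_add[OF rY]] by simp
  \<comment> \<open>In each mixed term \<open>S\<close> cancels one \<open>T\<close>;
    self-adjointness of \<open>S\<close> then shows that the two terms are equal.\<close>
  also have "\<dots> = (inner (basis_vec i) (?b j) + inner (basis_vec j) (?b i)) / 2"
    by (simp add: blinfun.add_right inner_add_left inner_add_right)
  also have "inner (basis_vec j) (?b i) = inner (?b j) (basis_vec i)"
    using S_self_adjoint[of "?b j" "?b i"] by (simp add: real_vec_T real_vec_basis_vec)
  also have "inner (basis_vec i) (?b j) = inner (?b j) (basis_vec i)"
    by (rule inner_commute)
  finally have "expectation (\<lambda>\<omega>. Y i \<omega> * Y j \<omega>) = Re (matrix_entry T i j)"
    by (simp add: inner_basis_vec matrix_entry_def)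
  moreover have "Im (matrix_entry T i j) = 0"
    using real_vec_T[OF real_vec_basis_vec[of j]] by (simp add: real_vec_def matrix_entry_def)
  ultimately show ?thesis by (simp add: complex_eq_iff)
qed

lemma Y_measurable [measurable]: "Y k \<in> borel_measurable M"
  using rep_integrable[OF rep_Y] by auto

text \<open>The family of the \<open>Y k\<close> already has the right law. Its image on the product
  space of sequences, with the coordinates as process, has a type independent of that of
  \<open>M\<close>.\<close>

lemma dual_process_exists:
  "\<exists>(N :: (int \<Rightarrow> real) measure) Z. centered_gaussian_with_cov N Z T"
proof (intro exI)
  define N where "N = distr M (PiM UNIV (\<lambda>_::int. borel :: real measure)) (\<lambda>\<omega> k. Y k \<omega>)"
  have m[measurable]: "(\<lambda>\<omega> k. Y k \<omega>) \<in> measurable M (PiM UNIV (\<lambda>_::int. borel :: real measure))"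
    by (rule measurable_PiM_single') auto
  interpret N: prob_space N unfolding N_def by (rule prob_space_distr[OF m])
  have coord_m[measurable]: "(\<lambda>f. f k) \<in> borel_measurable (PiM UNIV (\<lambda>_::int. borel :: real measure))" for k
    by (rule measurable_component_singleton) simp
  have sN[measurable_cong]: "sets N = sets (PiM UNIV (\<lambda>_::int. borel :: real measure))" by (simp add: N_def)
  have E: "N.expectation g = expectation (\<lambda>\<omega>. g (\<lambda>k. Y k \<omega>))"
    if "g \<in> borel_measurable (PiM UNIV (\<lambda>_::int. borel :: real measure))" for g :: "(int \<Rightarrow> real) \<Rightarrow> real"
    unfolding N_def by (rule integral_distr[OF m that])
  have g: "gaussian_rv N (\<lambda>f. \<Sum>k\<in>K. u k * f k)" if K: "finite K" for K u
  proof (rule N.scaled_normal_gaussian_rv)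
    note law = rep_law[OF rep_Y_sum[OF K, of u]]
    let ?q = "Q (blinfun_apply T (fin_vec K u))"
    show "(\<lambda>f. \<Sum>k\<in>K. u k * f k) \<in> borel_measurable N" by measurable
    have "distr N borel (\<lambda>f. \<Sum>k\<in>K. u k * f k) = distr M borel (\<lambda>\<omega>. \<Sum>k\<in>K. u k * Y k \<omega>)"
      unfolding N_def by (subst distr_distr) (auto simp: comp_def)
    then show "distr N borel (\<lambda>f. \<Sum>k\<in>K. u k * f k) = distr std_normal_distribution borel (\<lambda>x. sqrt ?q * x)"
      using law(2) by simp
    show "sqrt ?q \<ge> 0" using law(1) by simp
  qed
  show "centered_gaussian_with_cov N (\<lambda>k f. f k) T"
    unfolding centered_gaussian_with_cov_def gaussian_process_def
    using g N.prob_space_axioms rep_moments(1)[OF rep_Y]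
    by (auto simp: E expectation_Y_mult)
qed

end

theorem theorem5p1:
  fixes M :: "'a measure" and X :: "int \<Rightarrow> 'a \<Rightarrow> real"
    and S T :: "ell2 \<Rightarrow>\<^sub>L ell2"
  assumes "S \<in> bounded_ops" and "centered_gaussian_with_cov M X S"
    and "T \<in> bounded_ops" and "is_inverse_op S T"
    and "S \<in> BDO"
  shows "regular_process M X
    \<and> (\<exists>(N :: (int \<Rightarrow> real) measure) Y. centered_gaussian_with_cov N Y T)
    \<and> (\<forall>(N :: 'b measure) Y. centered_gaussian_with_cov N Y T \<longrightarrow> regular_process N Y)"
proof (intro conjI allI impI)
  interpret X: invertible_gaussian_sequence M X S T
    using assms by (auto simp: invertible_gaussian_sequence_def gaussian_sequence_def
        gaussian_sequence_axioms_def invertible_gaussian_sequence_axioms_def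
        centered_gaussian_with_cov_def gaussian_process_def)
  show "regular_process M X"
    unfolding regular_process_def using X.remote_past_trivial by blast
  show "\<exists>(N :: (int \<Rightarrow> real) measure) Y. centered_gaussian_with_cov N Y T"
    by (rule X.dual_process_exists)
  fix N :: "'b measure" and Y assume Y: "centered_gaussian_with_cov N Y T"
  \<comment> \<open>Being inverse is symmetric, so the argument applies to any process with
    covariance \<open>T\<close>, now with \<open>S\<close> in the role of the inverse.\<close>
  interpret Y: invertible_gaussian_sequence N Y T S
    using assms Y by (auto simp: invertible_gaussian_sequence_def gaussian_sequence_def
        gaussian_sequence_axioms_def invertible_gaussian_sequence_axioms_def is_inverse_op_def
        centered_gaussian_with_cov_def gaussian_process_def)
  show "regular_process N Y"
    unfolding regular_process_def using Y.remote_past_trivial by blast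
qed

end
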